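(* Let $G$ be a $\mathbf{W}$-object with Madden frame $L$. Every truncate sequence in $G$ has a pointwise join in $\mathcal{R}L$; that is, for every truncate sequence $\{g_n\}_{n\in\mathbb{N}}$ in $G$ there is $h\in\mathcal{R}L$ such that $h(r,\infty)=\bigvee_n\widehat g_n(r,\infty)$ in $L$ for all $r\in\mathbb{R}$.
   Context: $\mathbf{W}$ is the category of archimedean lattice-ordered groups $G$ with a designated weak order unit, written $1$ (so $1\ge 0$ and $g \wedge 1 = 0$ with $g \geq 0$ implies $g = 0$); morphisms are lattice-ordered group homomorphisms carrying designated unit to designated unit. $n$ ranges over the positive integers and also denotes the multiple $n\cdot 1$ of the unit. A $\mathbf{W}$-kernel of $G$ is the kernel of a $\mathbf{W}$-morphism out of $G$. For $S \subseteq G$, $[S]$ is the smallest $\mathbf{W}$-kernel of $G$ containing $S$. The $\mathbf{W}$-kernels of $G$, ordered by inclusion, form a (regular Lindelöf) frame $L = \mathcal{M}G$, the Madden frame of $G$. $\mathcal{O}\mathbb{R}$ is the frame of open subsets of $\mathbb{R}$, and $\mathcal{R}L$ is the set of frame maps $\mathcal{O}\mathbb{R} \to L$; write $f(r,\infty)$ for $f((r,\infty))$, and similarly for $f(-\infty,r)$. It is a $\mathbf{W}$-object, with operations lifted from those of $\mathbb{R}$, order $f \le g$ iff $f(r,\infty)\le g(r,\infty)$ for all $r \in \mathbb{R}$, and unit the map with $1(U)=\top$ if $1\in U$, $\bot$ otherwise. An element $f\in\mathcal{R}L$ is the pointwise join of $K\subseteq\mathcal{R}L$ if $f(r,\infty)=\bigvee_{k\in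 K}k(r,\infty)$ for all $r\in\mathbb{R}$. The Madden representation $G \to \mathcal{R}L$, $g \mapsto \widehat g$, is the injective $\mathbf{W}$-morphism with $\widehat g(r,\infty) = [(g-r)^+]$. If the constant $r$ is not in $G$ this is read as follows: for rational $r=p/q$, $q>0$, $[(g-r)^+]$ means $[(qg - p\cdot 1)^+]$, and for arbitrary real $r$ it is the join of these over rationals $s>r$. $G$ is identified with its image in $\mathcal{R}L$. A truncate sequence in $G$ is a sequence $\{g_n\}_{n\in\mathbb{N}}\subseteq G$ such that $g_{n+1}\wedge n=g_n$ for all $n$ and $\bigvee_n\widehat g_n(-\infty,n)=\top$ in $L$. *)

theory Defs
  imports Complex_Main "HOL-Algebra.Coset" "HOL-Algebra.Complete_Lattice"
begin

section \<open>Archimedean lattice-ordered groups with a designated weak unit\<close>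

record 'a wgroup = "'a gorder" +
  gplus :: "'a \<Rightarrow> 'a \<Rightarrow> 'a"
  gzero :: 'a
  gunit :: 'a

text \<open>The additive group of a \<open>wgroup\<close>, as a (multiplicatively written) group of the library;
  integer multiples are therefore powers in this group.\<close>

abbreviation add_group :: "('a, 'm) wgroup_scheme \<Rightarrow> 'a monoid" where
  "add_group G \<equiv> \<lparr>carrier = carrier G, monoid.mult = gplus G, one = gzero G\<rparr>"

definition zmult :: "('a, 'm) wgroup_scheme \<Rightarrow> int \<Rightarrow> 'a \<Rightarrow> 'a" where
  "zmult G k x = x [^]\<^bsub>add_group G\<^esub> k"

definition gminus :: "('a, 'm) wgroup_scheme \<Rightarrow> 'a \<Rightarrow> 'a \<Rightarrow> 'a" where
  "gminus G x y = gplus G x (inv\<^bsub>add_group G\<^esub> y)"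

definition pos_part :: "('a, 'm) wgroup_scheme \<Rightarrow> 'a \<Rightarrow> 'a" where
  "pos_part G x = x \<squnion>\<^bsub>G\<^esub> gzero G"

locale W_object = lattice G + add: comm_group "add_group G" for G (structure) +
  assumes translation:
      "\<lbrakk>a \<in> carrier G; b \<in> carrier G; c \<in> carrier G; a \<sqsubseteq> b\<rbrakk> \<Longrightarrow> gplus G c a \<sqsubseteq> gplus G c b"
    and archimedean:
      "\<lbrakk>a \<in> carrier G; b \<in> carrier G; gzero G \<sqsubseteq> a; \<And>n::nat. zmult G (int n) a \<sqsubseteq> b\<rbrakk>
        \<Longrightarrow> a = gzero G"
    and unit_closed: "gunit G \<in> carrier G"
    and unit_nonneg: "gzero G \<sqsubseteq> gunit G"
    and weak_unit:
      "\<lbrakk>g \<in> carrier G; gzero G \<sqsubseteq> g; g \<sqinter> gunit G = gzero G\<rbrakk> \<Longrightarrow> g = gzero G"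

definition W_morphism ::
  "('a, 'm) wgroup_scheme \<Rightarrow> ('b, 'n) wgroup_scheme \<Rightarrow> ('a \<Rightarrow> 'b) \<Rightarrow> bool" where
  "W_morphism G H \<phi> \<longleftrightarrow>
     \<phi> \<in> hom (add_group G) (add_group H) \<and> join_pres G H \<phi> \<and> meet_pres G H \<phi> \<and>
     \<phi> (gunit G) = gunit H"

text \<open>A definition cannot quantify over the type of the codomain. It suffices to look at codomains
  whose elements are sets of elements of \<open>G\<close>, because the image of a morphism can be
  replaced by the set of its fibres; lemma \<open>W_kernelI\<close> below proves that no kernels are lost.\<close>

definition W_kernel :: "('a, 'm) wgroup_scheme \<Rightarrow> 'a set \<Rightarrow> bool" where
  "W_kernel G K \<longleftrightarrow>
     (\<exists>(H :: 'a set wgroup) \<phi>. W_object H \<and> W_morphism G H \<phi> \<and>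
        K = kernel (add_group G) (add_group H) \<phi>)"

context W_object
begin

lemma join_props:
  assumes "x \<in> carrier G" "y \<in> carrier G"
  shows "least G (x \<squnion> y) (Upper G {x, y})"
  using assms sup_of_two_exists[OF assms] unfolding join_def sup_def by (metis someI_ex)

lemma meet_props:
  assumes "x \<in> carrier G" "y \<in> carrier G"
  shows "greatest G (x \<sqinter> y) (Lower G {x, y})"
  using assms inf_of_two_exists[OF assms] unfolding meet_def inf_def by (metis someI_ex)

end

lemma W_object_image:
  fixes H :: "('b, 'n) wgroup_scheme" and H' :: "'c wgroup" and d :: "'c \<Rightarrow> 'b"
  assumes H: "W_object H"
    and bij: "bij_betw d (carrier H') I" and IH: "I \<subseteq> carrier H"
    and eq: "eq H' = (=)"
    and le: "\<And>A B. A \<in> carrier H' \<Longrightarrow> B \<in> carrier H' \<Longrightarrow> le H' A B \<longleftrightarrow> le H (d A) (d B)"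
    and plus: "\<And>A B. A \<in> carrier H' \<Longrightarrow> B \<in> carrier H' \<Longrightarrow>
        gplus H' A B \<in> carrier H' \<and> d (gplus H' A B) = gplus H (d A) (d B)"
    and zero: "gzero H' \<in> carrier H'" "d (gzero H') = gzero H"
    and unit: "gunit H' \<in> carrier H'" "d (gunit H') = gunit H"
    and inv: "\<And>x. x \<in> I \<Longrightarrow> inv\<^bsub>add_group H\<^esub> x \<in> I"
    and join: "\<And>x y. x \<in> I \<Longrightarrow> y \<in> I \<Longrightarrow> x \<squnion>\<^bsub>H\<^esub> y \<in> I"
    and meet: "\<And>x y. x \<in> I \<Longrightarrow> y \<in> I \<Longrightarrow> x \<sqinter>\<^bsub>H\<^esub> y \<in> I"
  shows "W_object H'"
    and "\<And>A B. A \<in> carrier H' \<Longrightarrow> B \<in> carrier H' \<Longrightarrow> d (A \<squnion>\<^bsub>H'\<^esub> B) = d A \<squnion>\<^bsub>H\<^esub> d B"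
    and "\<And>A B. A \<in> carrier H' \<Longrightarrow> B \<in> carrier H' \<Longrightarrow> d (A \<sqinter>\<^bsub>H'\<^esub> B) = d A \<sqinter>\<^bsub>H\<^esub> d B"
proof -
  interpret H: W_object H by fact
  have dI: "\<And>A. A \<in> carrier H' \<Longrightarrow> d A \<in> I" using bij by (auto simp: bij_betw_def)
  have dH: "\<And>A. A \<in> carrier H' \<Longrightarrow> d A \<in> carrier H" using dI IH by auto
  have inj: "\<And>A B. A \<in> carrier H' \<Longrightarrow> B \<in> carrier H' \<Longrightarrow> d A = d B \<Longrightarrow> A = B"
    using bij by (auto simp: bij_betw_def inj_on_def)
  have sur: "\<And>y. y \<in> I \<Longrightarrow> \<exists>A\<in>carrier H'. d A = y" using bij by (auto simp: bij_betw_def)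
  have po: "partial_order H'"
  proof (unfold_locales, goal_cases)
    case (5 x y)
    then have "d x = d y" using le dH by (auto intro: H.le_antisym)
    then show ?case using 5 inj eq by simp
  next
    case (6 x y z) then show ?case using le dH H.le_trans[of "d x" "d y" "d z"] by simp
  qed (use eq le dH in auto)
  interpret P: partial_order H' by fact
  have L: "\<exists>S\<in>carrier H'. d S = d A \<squnion>\<^bsub>H\<^esub> d B \<and> least H' S (Upper H' {A, B})"
    if AB: "A \<in> carrier H'" "B \<in> carrier H'" for A B
  proof -
    obtain S where S: "S \<in> carrier H'" "d S = d A \<squnion>\<^bsub>H\<^esub> d B" using sur join dI AB by metis
    have "least H (d S) (Upper H {d A, d B})" using H.join_props[of "d A" "d B"] S dH that by auto
    then have "least H' S (Upper H' {A, B})"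
      unfolding least_def Upper_def using S(1) that dH le by auto
    then show ?thesis using S by auto
  qed
  have M: "\<exists>S\<in>carrier H'. d S = d A \<sqinter>\<^bsub>H\<^esub> d B \<and> greatest H' S (Lower H' {A, B})"
    if AB: "A \<in> carrier H'" "B \<in> carrier H'" for A B
  proof -
    obtain S where S: "S \<in> carrier H'" "d S = d A \<sqinter>\<^bsub>H\<^esub> d B" using sur meet dI AB by metis
    have "greatest H (d S) (Lower H {d A, d B})" using H.meet_props[of "d A" "d B"] S dH that by auto
    then have "greatest H' S (Lower H' {A, B})"
      unfolding greatest_def Lower_def using S(1) that dH le by auto
    then show ?thesis using S by auto
  qed
  interpret lattice H'
    apply unfold_locales using L M by blast+
  show j: "d (A \<squnion>\<^bsub>H'\<^esub> B) = d A \<squnion>\<^bsub>H\<^esub> d B" if AB: "A \<in> carrier H'" "B \<in> carrier H'" for A B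
  proof -
    obtain S where S: "S \<in> carrier H'" "d S = d A \<squnion>\<^bsub>H\<^esub> d B" "least H' S (Upper H' {A, B})"
      using L[OF AB] by blast
    then have "least H' (A \<squnion>\<^bsub>H'\<^esub> B) (Upper H' {A, B})"
      unfolding join_def sup_def by (metis someI_ex)
    then have "A \<squnion>\<^bsub>H'\<^esub> B = S" using S(3) by (metis P.least_unique)
    then show ?thesis using S by simp
  qed
  show m: "d (A \<sqinter>\<^bsub>H'\<^esub> B) = d A \<sqinter>\<^bsub>H\<^esub> d B" if AB: "A \<in> carrier H'" "B \<in> carrier H'" for A B
  proof -
    obtain S where S: "S \<in> carrier H'" "d S = d A \<sqinter>\<^bsub>H\<^esub> d B" "greatest H' S (Lower H' {A, B})"
      using M[OF AB] by blast
    then have "greatest H' (A \<sqinter>\<^bsub>H'\<^esub> B) (Lower H' {A, B})"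
      unfolding meet_def inf_def by (metis someI_ex)
    then have "A \<sqinter>\<^bsub>H'\<^esub> B = S" using S(3) by (metis P.greatest_unique)
    then show ?thesis using S by simp
  qed
  note pl = plus[THEN conjunct1] and dpl = plus[THEN conjunct2]
  have as: "\<And>x y z. x \<in> carrier H \<Longrightarrow> y \<in> carrier H \<Longrightarrow> z \<in> carrier H \<Longrightarrow>
      gplus H (gplus H x y) z = gplus H x (gplus H y z)"
    and cm: "\<And>x y. x \<in> carrier H \<Longrightarrow> y \<in> carrier H \<Longrightarrow> gplus H x y = gplus H y x"
    and z0: "\<And>x. x \<in> carrier H \<Longrightarrow> gplus H (gzero H) x = x"
    and li: "\<And>x. x \<in> carrier H \<Longrightarrow> gplus H (inv\<^bsub>add_group H\<^esub> x) x = gzero H"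
    using H.add.m_assoc H.add.m_comm H.add.l_one H.add.l_inv by simp_all
  have cg: "comm_group (add_group H')"
  proof (rule comm_groupI, goal_cases)
    case (3 x y z)
    then show ?case by (auto intro!: inj simp: pl dpl as dH)
  next
    case (4 x y)
    then show ?case by (auto intro!: inj simp: pl dpl cm dH)
  next
    case (5 x)
    then show ?case by (auto intro!: inj simp: pl dpl z0 zero dH)
  next
    case (6 x)
    then obtain y where y: "y \<in> carrier H'" "d y = inv\<^bsub>add_group H\<^esub> (d x)"
      using sur inv dI by (metis partial_object.select_convs(1))
    then have "gplus H' y x = gzero H'" using 6 by (auto intro!: inj simp: pl dpl li zero dH)
    then show ?case using y by auto
  qed (auto simp: pl zero)
  interpret cg: comm_group "add_group H'" by fact
  have zm: "zmult H' (int n) A \<in> carrier H' \<and> d (zmult H' (int n) A) = zmult H (int n) (d A)"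
    if "A \<in> carrier H'" for A n
    unfolding zmult_def int_pow_int
    by (induction n) (use that zero pl dpl in auto)
  show "W_object H'"
  proof (unfold_locales, goal_cases)
    case (1 a b c) then show ?case by (simp add: le pl dpl dH H.translation)
  next
    case (2 a b)
    then have "d a = gzero H"
      using H.archimedean[of "d a" "d b"] zm le dH zero by auto
    then show ?case using 2 inj zero by auto
  next
    case 3 show ?case by (rule unit)
  next
    case 4 show ?case using le zero unit H.unit_nonneg by simp
  next
    case (5 g)
    then have "d g \<sqinter>\<^bsub>H\<^esub> gunit H = gzero H" using m[of g "gunit H'"] unit zero by simp
    then have "d g = gzero H" using H.weak_unit[of "d g"] le[of "gzero H'" g] 5 zero dH by auto
    then show ?case using 5 inj zero by auto
  qed
qed

lemma W_kernelI:
  fixes G :: "('a, 'm) wgroup_scheme" and H :: "('b, 'n) wgroup_scheme"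
  assumes G: "W_object G" and H: "W_object H" and \<phi>: "W_morphism G H \<phi>"
  shows "W_kernel G (kernel (add_group G) (add_group H) \<phi>)"
proof -
  interpret G: W_object G by fact
  interpret H: W_object H by fact
  define I where "I = \<phi> ` carrier G"
  define e where "e y = {x \<in> carrier G. \<phi> x = y}" for y
  define d where "d A = \<phi> (SOME x. x \<in> A)" for A
  have hom: "\<phi> \<in> hom (add_group G) (add_group H)"
    and jp: "\<And>x y. x \<in> carrier G \<Longrightarrow> y \<in> carrier G \<Longrightarrow> \<phi> (x \<squnion>\<^bsub>G\<^esub> y) = \<phi> x \<squnion>\<^bsub>H\<^esub> \<phi> y"
    and mp: "\<And>x y. x \<in> carrier G \<Longrightarrow> y \<in> carrier G \<Longrightarrow> \<phi> (x \<sqinter>\<^bsub>G\<^esub> y) = \<phi> x \<sqinter>\<^bsub>H\<^esub> \<phi> y"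
    and un: "\<phi> (gunit G) = gunit H"
    using \<phi> by (simp_all add: W_morphism_def join_pres_def meet_pres_def)
  interpret \<phi>: group_hom "add_group G" "add_group H" \<phi>
    using hom by unfold_locales auto
  have cl: "\<And>x. x \<in> carrier G \<Longrightarrow> \<phi> x \<in> carrier H" using \<phi>.hom_closed by simp
  have pl: "\<And>x y. x \<in> carrier G \<Longrightarrow> y \<in> carrier G \<Longrightarrow> \<phi> (gplus G x y) = gplus H (\<phi> x) (\<phi> y)"
    using \<phi>.hom_mult by simp
  have plc: "\<And>x y. x \<in> carrier G \<Longrightarrow> y \<in> carrier G \<Longrightarrow> gplus G x y \<in> carrier G"
    using G.add.m_closed by simp
  have zc: "gzero G \<in> carrier G" "\<phi> (gzero G) = gzero H" using G.add.one_closed \<phi>.hom_one by simp_all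
  have de: "d (e y) = y" if "y \<in> I" for y
  proof -
    have "\<exists>x. x \<in> e y" using that by (auto simp: I_def e_def)
    then have "(SOME x. x \<in> e y) \<in> e y" by (rule someI_ex)
    then show ?thesis by (simp add: d_def e_def)
  qed
  define H' :: "'a set wgroup" where
    "H' = \<lparr>carrier = e ` I, eq = (=), le = (\<lambda>A B. le H (d A) (d B)),
        gplus = (\<lambda>A B. e (gplus H (d A) (d B))), gzero = e (gzero H), gunit = e (gunit H)\<rparr>"
  have bij: "bij_betw d (carrier H') I"
    by (rule bij_betw_byWitness[where f' = e]) (auto simp: H'_def de)
  have Ip: "gplus H x y \<in> I" if "x \<in> I" "y \<in> I" for x y
    using that pl plc unfolding I_def by (metis (no_types, lifting) image_iff)
  have I0: "gzero H \<in> I" using zc unfolding I_def by (metis image_eqI)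
  have I1: "gunit H \<in> I" using un G.unit_closed unfolding I_def by (metis image_eqI)
  have Ii: "inv\<^bsub>add_group H\<^esub> x \<in> I" if x: "x \<in> I" for x
  proof -
    obtain z where z: "z \<in> carrier G" "x = \<phi> z" using x by (auto simp: I_def)
    then have "\<phi> (inv\<^bsub>add_group G\<^esub> z) = inv\<^bsub>add_group H\<^esub> x" using \<phi>.hom_inv by simp
    moreover have "inv\<^bsub>add_group G\<^esub> z \<in> carrier G" using G.add.inv_closed[of z] z by simp
    ultimately show ?thesis unfolding I_def by (metis image_eqI)
  qed
  have Ij: "x \<squnion>\<^bsub>H\<^esub> y \<in> I" if x: "x \<in> I" and y: "y \<in> I" for x y
  proof -
    obtain a b where "a \<in> carrier G" "x = \<phi> a" "b \<in> carrier G" "y = \<phi> b"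
      using x y by (auto simp: I_def)
    then show ?thesis using jp[of a b] G.join_closed[of a b] unfolding I_def by (metis image_eqI)
  qed
  have Im: "x \<sqinter>\<^bsub>H\<^esub> y \<in> I" if x: "x \<in> I" and y: "y \<in> I" for x y
  proof -
    obtain a b where "a \<in> carrier G" "x = \<phi> a" "b \<in> carrier G" "y = \<phi> b"
      using x y by (auto simp: I_def)
    then show ?thesis using mp[of a b] G.meet_closed[of a b] unfolding I_def by (metis image_eqI)
  qed
  have sub: "I \<subseteq> carrier H" using cl by (auto simp: I_def)
  have cH': "\<And>A. A \<in> carrier H' \<longleftrightarrow> A \<in> e ` I" by (simp add: H'_def)
  have dI: "\<And>A. A \<in> carrier H' \<Longrightarrow> d A \<in> I" using cH' de by auto
  have eI: "\<And>y. y \<in> I \<Longrightarrow> e y \<in> carrier H'" using cH' by simp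
  have plH': "gplus H' A B \<in> carrier H' \<and> d (gplus H' A B) = gplus H (d A) (d B)"
    if "A \<in> carrier H'" "B \<in> carrier H'" for A B
  proof -
    have "gplus H' A B = e (gplus H (d A) (d B))" by (simp add: H'_def)
    then show ?thesis using eI de Ip dI that by simp
  qed
  have eqH': "eq H' = (=)" and leH': "\<And>A B. le H' A B \<longleftrightarrow> le H (d A) (d B)"
    and zH': "gzero H' = e (gzero H)" and uH': "gunit H' = e (gunit H)"
    by (simp_all add: H'_def)
  have zc': "gzero H' \<in> carrier H'" "d (gzero H') = gzero H"
    and uc': "gunit H' \<in> carrier H'" "d (gunit H') = gunit H"
    using eI de I0 I1 zH' uH' by simp_all
  note image = W_object_image[OF H bij sub eqH' leH' plH' zc' uc' Ii Ij Im]
  have W: "W_object H'" by (rule image)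
  have J: "\<And>A B. A \<in> carrier H' \<Longrightarrow> B \<in> carrier H' \<Longrightarrow> d (A \<squnion>\<^bsub>H'\<^esub> B) = d A \<squnion>\<^bsub>H\<^esub> d B"
    by (rule image)
  have M: "\<And>A B. A \<in> carrier H' \<Longrightarrow> B \<in> carrier H' \<Longrightarrow> d (A \<sqinter>\<^bsub>H'\<^esub> B) = d A \<sqinter>\<^bsub>H\<^esub> d B"
    by (rule image)
  interpret H': W_object H' by fact
  have inj: "\<And>A B. A \<in> carrier H' \<Longrightarrow> B \<in> carrier H' \<Longrightarrow> d A = d B \<Longrightarrow> A = B"
    using bij by (auto simp: bij_betw_def inj_on_def)
  have \<phi>I: "\<And>x. x \<in> carrier G \<Longrightarrow> \<phi> x \<in> I" by (simp add: I_def)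
  have "e (\<phi> (x \<squnion>\<^bsub>G\<^esub> y)) = e (\<phi> x) \<squnion>\<^bsub>H'\<^esub> e (\<phi> y)" if "x \<in> carrier G" "y \<in> carrier G" for x y
    by (rule inj) (use that in \<open>simp_all add: eI \<phi>I J de jp Ij H'.join_closed\<close>)
  moreover have "e (\<phi> (x \<sqinter>\<^bsub>G\<^esub> y)) = e (\<phi> x) \<sqinter>\<^bsub>H'\<^esub> e (\<phi> y)" if "x \<in> carrier G" "y \<in> carrier G" for x y
    by (rule inj) (use that in \<open>simp_all add: eI \<phi>I M de mp Im H'.meet_closed\<close>)
  moreover have "e (\<phi> (gplus G x y)) = gplus H' (e (\<phi> x)) (e (\<phi> y))"
    if "x \<in> carrier G" "y \<in> carrier G" for x y
    by (rule inj) (use that in \<open>simp_all add: eI \<phi>I plH' de pl Ip\<close>)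
  then have "(\<lambda>x. e (\<phi> x)) \<in> hom (add_group G) (add_group H')"
    by (simp add: hom_def eI \<phi>I)
  ultimately have mor: "W_morphism G H' (\<lambda>x. e (\<phi> x))"
    unfolding W_morphism_def join_pres_def meet_pres_def
    using G.lattice_axioms H'.lattice_axioms by (simp add: un uH')
  have "e (\<phi> x) = gzero H' \<longleftrightarrow> \<phi> x = gzero H" if "x \<in> carrier G" for x
    unfolding zH' using de[OF \<phi>I[OF that]] de[OF I0] by metis
  then have "kernel (add_group G) (add_group H) \<phi> = kernel (add_group G) (add_group H') (\<lambda>x. e (\<phi> x))"
    unfolding kernel_def by (simp cong: conj_cong)
  then show ?thesis unfolding W_kernel_def using W mor by blast
qed

definition W_kernel_generated :: "('a, 'm) wgroup_scheme \<Rightarrow> 'a set \<Rightarrow> 'a set" where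
  "W_kernel_generated G S = W_kernel G hull S"

definition madden_frame :: "('a, 'm) wgroup_scheme \<Rightarrow> 'a set gorder" where
  "madden_frame G = \<lparr>carrier = {K. W_kernel G K}, eq = (=), le = (\<subseteq>)\<rparr>"


section \<open>Frame maps on the frame of open sets of reals\<close>

definition open_reals :: "real set gorder" where
  "open_reals = \<lparr>carrier = {U. open U}, eq = (=), le = (\<subseteq>)\<rparr>"

text \<open>Frame maps are taken to be extensional so that they are determined by their values on the
  carrier. The empty join yields preservation of the bottom element.\<close>

definition frame_maps :: "('a, 'm) gorder_scheme \<Rightarrow> ('b, 'n) gorder_scheme \<Rightarrow> ('a \<Rightarrow> 'b) set" where
  "frame_maps M L =
     {f \<in> carrier M \<rightarrow>\<^sub>E carrier L. f \<top>\<^bsub>M\<^esub> = \<top>\<^bsub>L\<^esub> \<and> meet_pres M L f \<and> sup_pres M L f}"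

definition frame_reals :: "('b, 'n) gorder_scheme \<Rightarrow> (real set \<Rightarrow> 'b) set" where
  "frame_reals L = frame_maps open_reals L"

definition is_pointwise_join ::
  "('b, 'n) gorder_scheme \<Rightarrow> (real set \<Rightarrow> 'b) set \<Rightarrow> (real set \<Rightarrow> 'b) \<Rightarrow> bool" where
  "is_pointwise_join L K f \<longleftrightarrow>
     f \<in> frame_reals L \<and> K \<subseteq> frame_reals L \<and>
     (\<forall>r. f {r<..} = \<Squnion>\<^bsub>L\<^esub> ((\<lambda>k. k {r<..}) ` K))"


section \<open>The Madden representation and truncate sequences\<close>

text \<open>Frame maps from the open sets of reals are determined by their values on the rays
  \<open>{r<..}\<close>. For rational \<open>r = p / q\<close> the value prescribed on \<open>{r<..}\<close> is the kernel
  generated by the positive part of \<open>q g - p 1\<close>, and for real \<open>r\<close> it is the join of the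
  values at the rationals \<open>s > r\<close>.\<close>

definition madden_rep :: "('a, 'm) wgroup_scheme \<Rightarrow> 'a \<Rightarrow> real set \<Rightarrow> 'a set" where
  "madden_rep G g =
     (THE f. f \<in> frame_reals (madden_frame G) \<and>
        (\<forall>p q :: int. 0 < q \<longrightarrow>
           f {of_int p / of_int q<..} =
             W_kernel_generated G {pos_part G (gminus G (zmult G q g) (zmult G p (gunit G)))}) \<and>
        (\<forall>r. f {r<..} = \<Squnion>\<^bsub>madden_frame G\<^esub> {f {s<..} | s. s \<in> \<rat> \<and> r < s}))"

definition truncate_sequence :: "('a, 'm) wgroup_scheme \<Rightarrow> (nat \<Rightarrow> 'a) \<Rightarrow> bool" where
  "truncate_sequence G g \<longleftrightarrow>
     (\<forall>n\<ge>1. g n \<in> carrier G) \<and>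
     (\<forall>n\<ge>1. g (Suc n) \<sqinter>\<^bsub>G\<^esub> zmult G (int n) (gunit G) = g n) \<and>
     \<Squnion>\<^bsub>madden_frame G\<^esub> {madden_rep G (g n) {..<real n} | n. n \<ge> 1} = \<top>\<^bsub>madden_frame G\<^esub>"

end

theory Submission
  imports Defs "HOL-Algebra.Ring"
begin

text \<open>A subset of \<open>G\<close> is a W-kernel iff it is a convex l-subgroup \<open>K\<close> satisfying two closure
  conditions: \<open>(n a - b)\<^sup>+ \<in> K\<close> for all \<open>n\<close> forces \<open>a \<in> K\<close>, and \<open>a \<sqinter> 1 \<in> K\<close> forces \<open>a \<in> K\<close>
  (for \<open>a \<ge> 0\<close>). Hence W-kernels are closed under intersections and residuals and form a frame.
  A frame map on the open sets of reals amounts to a pair \<open>u, d\<close> of prospective values on the rays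
  \<open>{r<..}\<close> and \<open>{..<s}\<close> subject to a few cut axioms. For \<open>x \<in> G\<close> the Archimedean condition yields
  these axioms for the kernels generated by \<open>(q x - p)\<^sup>+\<close>. For a truncate sequence the upper values
  of \<open>g n\<close> increase with \<open>n\<close>, while the lower value at \<open>s\<close> is constant for \<open>n \<ge> s\<close>; so the joins
  of the upper values and the eventual lower values again form a cut, the last axiom
  being the covering condition on the sequence.\<close>

section \<open>Frame maps on the open sets of reals\<close>

text \<open>Joining the upper values of a sequence is harmless; the obstacle is the lower rays. As
  \<open>g n\<close> grows, its value on \<open>{..<s}\<close> shrinks, and an infinite meet of such
  values has no reason to cover \<open>L\<close> together with the joined upper values. Lower values
  are therefore carried as separate data, and truncation ensures that only finitely many stages can
  change the one at a given \<open>s\<close>. \<open>madden_rep\<close> is a definite description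
  that prescribes values on upper rays only. Nothing can be computed from it until a frame map with
  given ray values is known to exist and to be unique, so cuts are needed for each single element as
  well as for the final join. The definition of \<open>W_kernel\<close> quantifies over codomains,
  which hides closure under intersection. Closure conditions internal to \<open>G\<close> expose it;
  quotients show that they suffice. Real constants need not lie in \<open>G\<close>, so all ray
  values are generated by integer combinations of \<open>x\<close> and the unit. The archimedean
  condition reconciles the single generator prescribed at a rational with the join over larger
  rationals.\<close>

lemma open_reals_partial_order: "partial_order open_reals"
  by unfold_locales (auto simp: open_reals_def)

lemma open_reals_least:
  "\<U> \<subseteq> carrier open_reals \<Longrightarrow> least open_reals (\<Union>\<U>) (Upper open_reals \<U>)"
  by (auto simp: least_def Upper_def open_reals_def)

lemma open_reals_greatest:
  "\<U> \<subseteq> carrier open_reals \<Longrightarrow> greatest open_reals (\<Union>{V. open V \<and> V \<subseteq> \<Inter>\<U>}) (Lower open_reals \<U>)"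
  unfolding greatest_def Lower_def open_reals_def by simp blast

lemma open_reals_complete_lattice: "complete_lattice open_reals"
proof -
  interpret partial_order open_reals by (rule open_reals_partial_order)
  show ?thesis
    by unfold_locales (use open_reals_least open_reals_greatest in blast)+
qed

interpretation open_reals: complete_lattice open_reals
  by (rule open_reals_complete_lattice)

lemma open_reals_simps [simp]:
  "carrier open_reals = {U. open U}" "le open_reals = (\<subseteq>)"
  by (simp_all add: open_reals_def)

lemma open_reals_sup:
  assumes "\<U> \<subseteq> carrier open_reals"
  shows "\<Squnion>\<^bsub>open_reals\<^esub> \<U> = \<Union>\<U>"
  using open_reals.least_unique[OF open_reals.sup_lub open_reals_least] assms by simp

lemma open_reals_top: "\<top>\<^bsub>open_reals\<^esub> = UNIV"
  using open_reals.top_higher[of UNIV] by auto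

lemma open_reals_meet:
  assumes "open U" "open V"
  shows "U \<sqinter>\<^bsub>open_reals\<^esub> V = U \<inter> V"
proof (rule open_reals.le_antisym)
  show "U \<inter> V \<sqsubseteq>\<^bsub>open_reals\<^esub> U \<sqinter>\<^bsub>open_reals\<^esub> V"
    using assms by (intro open_reals.meet_le) auto
qed (use assms open_reals.meet_left[of U V] open_reals.meet_right[of U V] open_reals.meet_closed[of U V] in auto)

lemma frame_realsI:
  assumes "complete_lattice L" "f \<in> {U. open U} \<rightarrow>\<^sub>E carrier L" "f UNIV = \<top>\<^bsub>L\<^esub>"
    and "\<And>U V. \<lbrakk>open U; open V\<rbrakk> \<Longrightarrow> f (U \<inter> V) = f U \<sqinter>\<^bsub>L\<^esub> f V"
    and "\<And>\<U>. \<forall>U\<in>\<U>. open U \<Longrightarrow> f (\<Union>\<U>) = \<Squnion>\<^bsub>L\<^esub> (f ` \<U>)"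
  shows "f \<in> frame_reals L"
proof -
  interpret complete_lattice L by fact
  have "\<U> \<subseteq> {U. open U} \<longleftrightarrow> (\<forall>U\<in>\<U>. open U)" for \<U> :: "real set set" by auto
  then show ?thesis
    using assms lattice_axioms open_reals.lattice_axioms complete_lattice_axioms open_reals_complete_lattice
    unfolding frame_reals_def frame_maps_def meet_pres_def sup_pres_def
    by (simp add: open_reals_top open_reals_meet open_reals_sup)
qed

lemma frame_realsD:
  assumes "f \<in> frame_reals L"
  shows "f \<in> {U. open U} \<rightarrow>\<^sub>E carrier L" "f UNIV = \<top>\<^bsub>L\<^esub>"
    and "\<And>U V. \<lbrakk>open U; open V\<rbrakk> \<Longrightarrow> f (U \<inter> V) = f U \<sqinter>\<^bsub>L\<^esub> f V"
    and "\<And>\<U>. \<forall>U\<in>\<U>. open U \<Longrightarrow> f (\<Union>\<U>) = \<Squnion>\<^bsub>L\<^esub> (f ` \<U>)"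
proof -
  have *: "f \<in> carrier open_reals \<rightarrow>\<^sub>E carrier L" "f \<top>\<^bsub>open_reals\<^esub> = \<top>\<^bsub>L\<^esub>"
    "meet_pres open_reals L f" "sup_pres open_reals L f"
    using assms by (auto simp: frame_reals_def frame_maps_def)
  then show "f \<in> {U. open U} \<rightarrow>\<^sub>E carrier L" "f UNIV = \<top>\<^bsub>L\<^esub>"
    by (simp_all add: open_reals_top)
  show "f (U \<inter> V) = f U \<sqinter>\<^bsub>L\<^esub> f V" if "open U" "open V" for U V
    using *(3) that by (simp add: meet_pres_def flip: open_reals_meet)
  show "f (\<Union>\<U>) = \<Squnion>\<^bsub>L\<^esub> (f ` \<U>)" if "\<forall>U\<in>\<U>. open U" for \<U>
  proof -
    have "\<U> \<subseteq> carrier open_reals" using that by auto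
    then show ?thesis using *(4) by (simp add: sup_pres_def flip: open_reals_sup)
  qed
qed

lemma rational_between:
  fixes r s :: real
  assumes "r < s"
  obtains p q :: int where "0 < q" "r < of_int p / of_int q" "of_int p / of_int q < s"
proof -
  obtain t where "t \<in> \<rat>" "r < t" "t < s" using Rats_dense_in_real[OF assms] by blast
  then show thesis using that by (metis Rats_cases')
qed

lemma open_real_interval:
  fixes U :: "real set"
  assumes "open U" "x \<in> U"
  obtains \<epsilon> where "\<epsilon> > 0" "{x - \<epsilon><..<x + \<epsilon>} \<subseteq> U"
proof -
  obtain \<epsilon> where "\<epsilon> > 0" "\<forall>y. dist y x < \<epsilon> \<longrightarrow> y \<in> U" using assms unfolding open_dist by blast
  then have "{x - \<epsilon><..<x + \<epsilon>} \<subseteq> U" by (auto simp: dist_real_def)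
  with \<open>\<epsilon> > 0\<close> show thesis by (rule that)
qed

section \<open>Frames, and cuts that present frame maps on the reals\<close>

locale frame = complete_lattice +
  assumes meet_sup_le:
    "\<lbrakk>x \<in> carrier L; A \<subseteq> carrier L; y \<in> carrier L; \<And>a. a \<in> A \<Longrightarrow> x \<sqinter> a \<sqsubseteq> y\<rbrakk> \<Longrightarrow> x \<sqinter> \<Squnion>A \<sqsubseteq> y"
begin

text \<open>By distributivity the join of all \<open>z\<close> with
  \<open>x \<sqinter> z \<sqsubseteq> y\<close> is itself such a \<open>z\<close>: the Heyting
  implication. It moves one factor of a meet to the other side, so that cut axioms phrased as plain
  inequalities apply underneath a meet.\<close>

lemma residual:
  assumes "x \<in> carrier L" "y \<in> carrier L"
  obtains w where "w \<in> carrier L" "\<And>z. z \<in> carrier L \<Longrightarrow> z \<sqsubseteq> w \<longleftrightarrow> x \<sqinter> z \<sqsubseteq> y"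
proof
  let ?A = "{z \<in> carrier L. x \<sqinter> z \<sqsubseteq> y}"
  show w: "\<Squnion>?A \<in> carrier L" by (rule sup_closed) auto
  fix z assume z: "z \<in> carrier L"
  show "z \<sqsubseteq> \<Squnion>?A \<longleftrightarrow> x \<sqinter> z \<sqsubseteq> y"
  proof
    assume "z \<sqsubseteq> \<Squnion>?A"
    then have "x \<sqinter> z \<sqsubseteq> x \<sqinter> \<Squnion>?A"
      using assms z w by (intro meet_le) (auto simp: meet_left intro: le_trans[OF meet_right])
    also have "x \<sqinter> \<Squnion>?A \<sqsubseteq> y" using assms by (intro meet_sup_le) auto
    finally show "x \<sqinter> z \<sqsubseteq> y" using assms z w by simp
  qed (use z in \<open>auto intro!: sup_upper\<close>)
qed

end

text \<open>A frame map on the open sets of reals, presented by its values \<open>u r\<close> on \<open>{r<..}\<close> and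
  \<open>d s\<close> on \<open>{..<s}\<close>. Joins occur only through their universal property.\<close>

locale real_cut = frame +
  fixes u d :: "real \<Rightarrow> 'a"
  assumes u_closed [simp]: "u r \<in> carrier L" and d_closed [simp]: "d s \<in> carrier L"
    and disjoint: "s \<le> r \<Longrightarrow> u r \<sqinter> d s = \<bottom>"
    and cover: "\<lbrakk>r < s; u r \<sqsubseteq> y; d s \<sqsubseteq> y; y \<in> carrier L\<rbrakk> \<Longrightarrow> y = \<top>"
    and u_antimono: "r \<le> s \<Longrightarrow> u s \<sqsubseteq> u r"
    and d_mono: "r \<le> s \<Longrightarrow> d r \<sqsubseteq> d s"
    and u_approx: "\<lbrakk>\<And>s. r < s \<Longrightarrow> u s \<sqsubseteq> y; y \<in> carrier L\<rbrakk> \<Longrightarrow> u r \<sqsubseteq> y"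
    and d_approx: "\<lbrakk>\<And>r. r < s \<Longrightarrow> d r \<sqsubseteq> y; y \<in> carrier L\<rbrakk> \<Longrightarrow> d s \<sqsubseteq> y"
    and u_top: "\<lbrakk>\<And>r. u r \<sqsubseteq> y; y \<in> carrier L\<rbrakk> \<Longrightarrow> y = \<top>"
    and d_top: "\<lbrakk>\<And>s. d s \<sqsubseteq> y; y \<in> carrier L\<rbrakk> \<Longrightarrow> y = \<top>"
begin

abbreviation box :: "real \<Rightarrow> real \<Rightarrow> 'a" where
  "box r s \<equiv> u r \<sqinter> d s"

definition cut_map :: "real set \<Rightarrow> 'a" where
  "cut_map = (\<lambda>U\<in>{U. open U}. \<Squnion>{box r s | r s. {r<..<s} \<subseteq> U})"

lemma boxes_closed: "{box r s | r s. P r s} \<subseteq> carrier L"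
  by auto

lemma cut_map_closed [simp]: "open U \<Longrightarrow> cut_map U \<in> carrier L"
  using boxes_closed by (simp add: cut_map_def)

lemma box_le_cut_map: "\<lbrakk>{r<..<s} \<subseteq> U; open U\<rbrakk> \<Longrightarrow> box r s \<sqsubseteq> cut_map U"
  unfolding cut_map_def by (auto intro!: sup_upper)

lemma cut_map_le:
  "\<lbrakk>\<And>r s. {r<..<s} \<subseteq> U \<Longrightarrow> box r s \<sqsubseteq> y; open U; y \<in> carrier L\<rbrakk> \<Longrightarrow> cut_map U \<sqsubseteq> y"
  unfolding cut_map_def by (auto intro!: sup_least)

lemma cut_map_mono: "\<lbrakk>U \<subseteq> V; open U; open V\<rbrakk> \<Longrightarrow> cut_map U \<sqsubseteq> cut_map V"
  by (intro cut_map_le box_le_cut_map) auto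

lemma box_mono: "\<lbrakk>r' \<le> r; s \<le> s'\<rbrakk> \<Longrightarrow> box r s \<sqsubseteq> box r' s'"
  using u_antimono[of r' r] d_mono[of s s']
  by (intro meet_le) (auto intro: le_trans[OF meet_left] le_trans[OF meet_right])

text \<open>\<open>d_approx\<close> and \<open>u_approx\<close> are applied one after the other,
  each time with the other factor moved into a residual. This provides the room needed to replace an
  open interval by compact ones.\<close>

lemma box_approx:
  assumes "\<And>r' s'. \<lbrakk>r < r'; s' < s\<rbrakk> \<Longrightarrow> box r' s' \<sqsubseteq> y" "y \<in> carrier L"
  shows "box r s \<sqsubseteq> y"
proof -
  have *: "box r' s \<sqsubseteq> y" if "r < r'" for r'
  proof -
    obtain w where w: "w \<in> carrier L" "\<And>z. z \<in> carrier L \<Longrightarrow> z \<sqsubseteq> w \<longleftrightarrow> u r' \<sqinter> z \<sqsubseteq> y"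
      using residual[of "u r'" y] assms by auto
    show ?thesis using d_approx[of s w] w assms that by simp
  qed
  obtain w where w: "w \<in> carrier L" "\<And>z. z \<in> carrier L \<Longrightarrow> z \<sqsubseteq> w \<longleftrightarrow> d s \<sqinter> z \<sqsubseteq> y"
    using residual[of "d s" y] assms by auto
  then show ?thesis using u_approx[of r w] * by (simp add: meet_comm)
qed

text \<open>The residual of \<open>y\<close> by \<open>box r s\<close> lies above
  \<open>u r'\<close> and above \<open>d s'\<close>; these two cover because \<open>r' < s'\<close>,
  so the residual is top.\<close>

lemma box_overlap:
  assumes "box r s' \<sqsubseteq> y" "box r' s \<sqsubseteq> y" "r' < s'" "r \<le> r'" "s' \<le> s" and y: "y \<in> carrier L"
  shows "box r s \<sqsubseteq> y"
proof -
  obtain w where w: "w \<in> carrier L" "\<And>z. z \<in> carrier L \<Longrightarrow> z \<sqsubseteq> w \<longleftrightarrow> box r s \<sqinter> z \<sqsubseteq> y"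
    using residual[of "box r s" y] y by auto
  have "box r s \<sqinter> u r' \<sqsubseteq> box r' s"
    by (intro meet_le) (auto intro: meet_right le_trans[OF meet_left meet_right])
  then have "box r s \<sqinter> u r' \<sqsubseteq> y" using assms(2) y le_trans[of "box r s \<sqinter> u r'" "box r' s" y] by simp
  moreover have "box r s \<sqinter> d s' \<sqsubseteq> box r s'"
    by (intro meet_le) (auto intro: meet_right le_trans[OF meet_left meet_left])
  then have "box r s \<sqinter> d s' \<sqsubseteq> y" using assms(1) y le_trans[of "box r s \<sqinter> d s'" "box r s'" y] by simp
  ultimately have "w = \<top>" using cover[of r' s' w] assms(3) w by simp
  then show ?thesis using w(2)[of "box r s"] top_higher[of "box r s"]
      meet_le[of "box r s" "box r s" "box r s"] le_trans[of "box r s" "box r s \<sqinter> box r s" y] y by simp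
qed

text \<open>Compactness of \<open>{a..b}\<close> enters through the bisection principle.\<close>

lemma box_le_of_cover:
  assumes cover: "{a..b} \<subseteq> \<Union>\<U>" and "\<forall>U\<in>\<U>. open U" and y: "y \<in> carrier L"
    and le: "\<And>r s U. \<lbrakk>U \<in> \<U>; {r<..<s} \<subseteq> U\<rbrakk> \<Longrightarrow> box r s \<sqsubseteq> y"
  shows "box a b \<sqsubseteq> y"
proof (cases "a \<le> b")
  case False
  then have "box a b = \<bottom>" by (intro disjoint) simp
  then show ?thesis using y by simp
next
  case True
  \<comment> \<open>Widening each piece by some \<open>e > 0\<close> makes adjacent pieces overlap,
    since \<open>box_overlap\<close> cannot glue intervals that only touch. The guards confine
    \<open>P\<close> to subintervals of \<open>{a..b}\<close>.\<close>
  define P where "P p q \<longleftrightarrow> a \<le> p \<longrightarrow> q \<le> b \<longrightarrow> (\<exists>e>0. box (p - e) (q + e) \<sqsubseteq> y)" for p q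
  have "P a b"
    using True
  proof (induction rule: Bolzano)
    case (trans p q t)
    show ?case unfolding P_def
    proof (intro impI)
      assume "a \<le> p" "t \<le> b"
      then obtain e1 e2 where e: "e1 > 0" "e2 > 0" "box (p - e1) (q + e1) \<sqsubseteq> y" "box (q - e2) (t + e2) \<sqsubseteq> y"
        using trans unfolding P_def by force
      let ?e = "min e1 e2"
      have "box (p - ?e) (q + ?e) \<sqsubseteq> y"
        using e(3) box_mono[of "p - e1" "p - ?e" "q + ?e" "q + e1"] y
          le_trans[of "box (p - ?e) (q + ?e)" "box (p - e1) (q + e1)" y] by simp
      moreover have "box (q - ?e) (t + ?e) \<sqsubseteq> y"
        using e(4) box_mono[of "q - e2" "q - ?e" "t + ?e" "t + e2"] y
          le_trans[of "box (q - ?e) (t + ?e)" "box (q - e2) (t + e2)" y] by simp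
      ultimately have "box (p - ?e) (t + ?e) \<sqsubseteq> y"
        using box_overlap[of "p - ?e" "q + ?e" y "q - ?e" "t + ?e"] trans(3,4) e(1,2) y
        by (simp add: min_def split: if_splits)
      then show "\<exists>e>0. box (p - e) (t + e) \<sqsubseteq> y" using e(1,2) by (intro exI[of _ ?e]) simp
    qed
  next
    case (local x)
    then obtain U where U: "U \<in> \<U>" "x \<in> U" using cover by auto
    then obtain \<epsilon> where \<epsilon>: "\<epsilon> > 0" "{x - \<epsilon><..<x + \<epsilon>} \<subseteq> U"
      using assms(2) open_real_interval by blast
    have "P p q" if "p \<le> x" "x \<le> q" "q - p < \<epsilon> / 2" for p q
    proof -
      \<comment> \<open>Both \<open>p\<close> and \<open>q\<close> are within
        \<open>\<epsilon> / 2\<close> of \<open>x\<close>, so widening by another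
        \<open>\<epsilon> / 2\<close> stays inside \<open>U\<close>.\<close>
      have "{p - \<epsilon> / 2<..<q + \<epsilon> / 2} \<subseteq> {x - \<epsilon><..<x + \<epsilon>}"
        using that by auto
      then have "box (p - \<epsilon> / 2) (q + \<epsilon> / 2) \<sqsubseteq> y" using le U \<epsilon> by blast
      then show ?thesis using \<epsilon>(1) unfolding P_def by (intro impI exI[of _ "\<epsilon> / 2"]) simp
    qed
    then show ?case using \<epsilon>(1) by (intro exI[of _ "\<epsilon> / 2"]) auto
  qed
  then obtain e where "e > 0" "box (a - e) (b + e) \<sqsubseteq> y" using P_def by auto
  then show ?thesis using box_mono[of "a - e" a b "b + e"] y
      le_trans[of "box a b" "box (a - e) (b + e)" y] by simp
qed

text \<open>An open interval inside the union is not compact, so \<open>box_approx\<close> first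
  shrinks it; the closed interval \<open>{r'..s'}\<close> is then covered by the family and
  \<open>box_le_of_cover\<close> applies.\<close>

lemma cut_map_Union:
  assumes "\<forall>U\<in>\<U>. open U"
  shows "cut_map (\<Union>\<U>) = \<Squnion>(cut_map ` \<U>)"
proof (rule le_antisym)
  have sub: "cut_map ` \<U> \<subseteq> carrier L" using assms by auto
  then show c: "\<Squnion>(cut_map ` \<U>) \<in> carrier L" by simp
  show "cut_map (\<Union>\<U>) \<sqsubseteq> \<Squnion>(cut_map ` \<U>)"
  proof (rule cut_map_le, rule box_approx)
    fix r s r' s' assume *: "{r<..<s} \<subseteq> \<Union>\<U>" "r < r'" "s' < s"
    show "box r' s' \<sqsubseteq> \<Squnion>(cut_map ` \<U>)"
    proof (rule box_le_of_cover[OF _ assms])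
      have "{r'..s'} \<subseteq> {r<..<s}" using *(2,3) by auto
      then show "{r'..s'} \<subseteq> \<Union>\<U>" using *(1) by (rule subset_trans)
      fix p q U assume "U \<in> \<U>" "{p<..<q} \<subseteq> U"
      then show "box p q \<sqsubseteq> \<Squnion>(cut_map ` \<U>)"
        using assms sub c sup_upper[OF sub, of "cut_map U"] box_le_cut_map[of p q U]
          le_trans[of "box p q" "cut_map U" "\<Squnion>(cut_map ` \<U>)"] by simp
    qed (rule c)
  qed (use assms c in \<open>auto intro!: open_Union\<close>)
  show "\<Squnion>(cut_map ` \<U>) \<sqsubseteq> cut_map (\<Union>\<U>)"
    using assms sub by (intro sup_least cut_map_closed open_Union) (auto intro!: cut_map_mono open_Union)
qed (use assms in \<open>auto intro!: cut_map_closed open_Union\<close>)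

text \<open>An interval inside the ray either starts at or after \<open>r\<close> or is empty, and
  the empty ones have bottom boxes. Conversely each \<open>box r s\<close> lies below the value, so
  the residual by \<open>u r\<close> contains every \<open>d s\<close> and is top by
  \<open>d_top\<close>.\<close>

lemma cut_map_greaterThan: "cut_map {r<..} = u r"
proof (rule le_antisym)
  show "cut_map {r<..} \<sqsubseteq> u r"
  proof (rule cut_map_le)
    fix p q assume "{p<..<q} \<subseteq> {r<..}"
    then consider "r \<le> p" | "q \<le> p" using dense[of p "min r q"] by force
    then show "box p q \<sqsubseteq> u r"
    proof cases
      case 1
      then show ?thesis using u_antimono[of r p] le_trans[OF meet_left, of "u p" "d q" "u r"] by simp
    qed (simp add: disjoint)
  qed auto
  obtain w where w: "w \<in> carrier L" "\<And>z. z \<in> carrier L \<Longrightarrow> z \<sqsubseteq> w \<longleftrightarrow> u r \<sqinter> z \<sqsubseteq> cut_map {r<..}"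
    using residual[of "u r" "cut_map {r<..}"] by auto
  have "box r s \<sqsubseteq> cut_map {r<..}" for s by (rule box_le_cut_map) auto
  then have "w = \<top>" using d_top[of w] w by simp
  then have "u r \<sqinter> u r \<sqsubseteq> cut_map {r<..}" using w(2)[of "u r"] by (simp add: top_higher)
  then show "u r \<sqsubseteq> cut_map {r<..}"
    using meet_le[of "u r" "u r" "u r"] le_trans[of "u r" "u r \<sqinter> u r" "cut_map {r<..}"] by simp
qed auto

lemma cut_map_lessThan: "cut_map {..<s} = d s"
proof (rule le_antisym)
  show "cut_map {..<s} \<sqsubseteq> d s"
  proof (rule cut_map_le)
    fix p q assume "{p<..<q} \<subseteq> {..<s}"
    then consider "q \<le> s" | "q \<le> p" using dense[of "max s p" q] by force
    then show "box p q \<sqsubseteq> d s"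
    proof cases
      case 1
      then show ?thesis using d_mono[of q s] le_trans[OF meet_right, of "u p" "d q" "d s"] by simp
    qed (simp add: disjoint)
  qed auto
  obtain w where w: "w \<in> carrier L" "\<And>z. z \<in> carrier L \<Longrightarrow> z \<sqsubseteq> w \<longleftrightarrow> d s \<sqinter> z \<sqsubseteq> cut_map {..<s}"
    using residual[of "d s" "cut_map {..<s}"] by auto
  have "box r s \<sqsubseteq> cut_map {..<s}" for r by (rule box_le_cut_map) auto
  then have "w = \<top>" using u_top[of w] w by (simp add: meet_comm)
  then have "d s \<sqinter> d s \<sqsubseteq> cut_map {..<s}" using w(2)[of "d s"] by (simp add: top_higher)
  then show "d s \<sqsubseteq> cut_map {..<s}"
    using meet_le[of "d s" "d s" "d s"] le_trans[of "d s" "d s \<sqinter> d s" "cut_map {..<s}"] by simp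
qed auto

text \<open>Two residuals, one for each factor, reduce the nontrivial inequality to a meet of two
  boxes, which lies below the box of the intersected interval.\<close>

lemma cut_map_Int:
  assumes [simp]: "open U" "open V"
  shows "cut_map (U \<inter> V) = cut_map U \<sqinter> cut_map V"
proof (rule le_antisym)
  show "cut_map (U \<inter> V) \<sqsubseteq> cut_map U \<sqinter> cut_map V"
    by (intro meet_le cut_map_mono cut_map_closed open_Int) auto
  have UV: "cut_map (U \<inter> V) \<in> carrier L" by (intro cut_map_closed open_Int) auto
  obtain w where w: "w \<in> carrier L" "\<And>z. z \<in> carrier L \<Longrightarrow> z \<sqsubseteq> w \<longleftrightarrow> cut_map V \<sqinter> z \<sqsubseteq> cut_map (U \<inter> V)"
    using residual[of "cut_map V" "cut_map (U \<inter> V)"] UV by auto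
  have "box p q \<sqsubseteq> w" if pq: "{p<..<q} \<subseteq> U" for p q
  proof -
    obtain v where v: "v \<in> carrier L" "\<And>z. z \<in> carrier L \<Longrightarrow> z \<sqsubseteq> v \<longleftrightarrow> box p q \<sqinter> z \<sqsubseteq> cut_map (U \<inter> V)"
      using residual[of "box p q" "cut_map (U \<inter> V)"] UV by auto
    have "box r s \<sqsubseteq> v" if rs: "{r<..<s} \<subseteq> V" for r s
    proof -
      have *: "box p q \<sqinter> box r s \<sqsubseteq> u p" "box p q \<sqinter> box r s \<sqsubseteq> u r"
        "box p q \<sqinter> box r s \<sqsubseteq> d q" "box p q \<sqinter> box r s \<sqsubseteq> d s"
        by (auto intro: le_trans[OF meet_left meet_left] le_trans[OF meet_left meet_right]
            le_trans[OF meet_right meet_left] le_trans[OF meet_right meet_right])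
      have "box p q \<sqinter> box r s \<sqsubseteq> box (max p r) (min q s)"
        by (rule meet_le) (use * in \<open>auto simp: max_def min_def\<close>)
      moreover have "box (max p r) (min q s) \<sqsubseteq> cut_map (U \<inter> V)"
        using pq rs by (intro box_le_cut_map) auto
      ultimately show ?thesis
        using UV v(2)[of "box r s"] le_trans[of "box p q \<sqinter> box r s" "box (max p r) (min q s)" "cut_map (U \<inter> V)"]
        by simp
    qed
    then have "cut_map V \<sqsubseteq> v" using v(1) by (intro cut_map_le) auto
    then show ?thesis using v(2)[of "cut_map V"] w(2)[of "box p q"] by (simp add: meet_comm)
  qed
  then have "cut_map U \<sqsubseteq> w" using w(1) by (intro cut_map_le) auto
  then show "cut_map U \<sqinter> cut_map V \<sqsubseteq> cut_map (U \<inter> V)" using w(2)[of "cut_map U"] by (simp add: meet_comm)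
qed (auto intro!: cut_map_closed open_Int)

lemma cut_map_UNIV: "cut_map UNIV = \<top>"
proof (rule u_top)
  fix r show "u r \<sqsubseteq> cut_map UNIV"
    using cut_map_mono[of "{r<..}" UNIV] by (simp add: cut_map_greaterThan)
qed simp

theorem cut_map_frame_reals: "cut_map \<in> frame_reals L"
proof (rule frame_realsI[OF complete_lattice_axioms])
  show "cut_map \<in> {U. open U} \<rightarrow>\<^sub>E carrier L"
    unfolding PiE_iff using cut_map_closed by (auto simp: cut_map_def extensional_def)
qed (simp_all add: cut_map_UNIV cut_map_Int cut_map_Union)

lemma open_eq_Union_intervals: "open U \<Longrightarrow> U = \<Union>{{r<..<s} | r s :: real. {r<..<s} \<subseteq> U}"
proof (intro equalityI subsetI)
  fix x assume "open U" "x \<in> U"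
  then obtain \<epsilon> where "\<epsilon> > 0" "{x - \<epsilon><..<x + \<epsilon>} \<subseteq> U" using open_real_interval by blast
  then have "{x - \<epsilon><..<x + \<epsilon>} \<subseteq> U" "x \<in> {x - \<epsilon><..<x + \<epsilon>}" by auto
  then show "x \<in> \<Union>{{r<..<s} | r s. {r<..<s} \<subseteq> U}" by blast
qed auto

text \<open>Upper rays determine the lower ones: disjointness from \<open>u r\<close> bounds a lower
  value from above, and covering together with \<open>u r\<close> bounds it from below. Every open
  set is a union of intervals, hence of meets of two rays. This is the uniqueness half needed for
  the definite description in \<open>madden_rep\<close>.\<close>

theorem frame_reals_eq_cut_map:
  assumes f: "f \<in> frame_reals L" and u: "\<And>r. f {r<..} = u r"
  shows "f = cut_map"
proof -
  note fD = frame_realsD[OF f]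
  have cl [simp]: "f U \<in> carrier L" if "open U" for U using fD(1) that by auto
  have "\<Squnion>{} = \<bottom>" using weak_sup_empty by (simp add: eq_is_equal)
  then have empty: "f {} = \<bottom>" using fD(4)[of "{}"] by simp
  have Un_le: "f (\<Union>\<U>) \<sqsubseteq> y" if "\<forall>U\<in>\<U>. open U" "\<And>U. U \<in> \<U> \<Longrightarrow> f U \<sqsubseteq> y" "y \<in> carrier L" for \<U> y
    unfolding fD(4)[OF that(1)] using that by (intro sup_least) auto
  have d: "f {..<s} = d s" for s
  proof (rule le_antisym)
    have "f {..<r} \<sqsubseteq> d s" if "r < s" for r
    proof -
      \<comment> \<open>The residual \<open>w\<close> contains \<open>u r\<close>, which
        \<open>f\<close> keeps disjoint from \<open>{..<r}\<close>, and it contains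
        \<open>d s\<close> trivially; since \<open>r < s\<close>, \<open>cover\<close> makes it
        top.\<close>
      obtain w where w: "w \<in> carrier L" "\<And>z. z \<in> carrier L \<Longrightarrow> z \<sqsubseteq> w \<longleftrightarrow> f {..<r} \<sqinter> z \<sqsubseteq> d s"
        using residual[of "f {..<r}" "d s"] by auto
      have "{..<r} \<inter> {r<..} = {}" by auto
      then have "f {..<r} \<sqinter> u r = \<bottom>" using fD(3)[of "{..<r}" "{r<..}"] u empty by simp
      then have "w = \<top>" using cover[OF that, of w] w by (simp add: meet_right)
      then have "f {..<r} \<sqinter> f {..<r} \<sqsubseteq> d s" using w(2)[of "f {..<r}"] by (simp add: top_higher)
      then show ?thesis using fD(3)[of "{..<r}" "{..<r}"] by simp
    qed
    moreover have "x \<in> \<Union>{{..<r} | r. r < s}" if "x < s" for x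
      using dense[OF that] by blast
    then have "{..<s} = \<Union>{{..<r} | r. r < s}" by auto
    moreover have "f (\<Union>{{..<r} | r. r < s}) \<sqsubseteq> d s" by (rule Un_le) (use calculation(1) in auto)
    ultimately show "f {..<s} \<sqsubseteq> d s" by simp
    show "d s \<sqsubseteq> f {..<s}"
    proof (rule d_approx)
      fix r assume r: "r < s"
      obtain w where w: "w \<in> carrier L" "\<And>z. z \<in> carrier L \<Longrightarrow> z \<sqsubseteq> w \<longleftrightarrow> d r \<sqinter> z \<sqsubseteq> f {..<s}"
        using residual[of "d r" "f {..<s}"] by auto
      \<comment> \<open>The same argument with the roles of \<open>f\<close> and \<open>d\<close>
        exchanged: here the covering comes from preservation of the join, the disjointness from the
        cut axiom.\<close>
      have "f (\<Union>{{r<..}, {..<s}}) \<sqsubseteq> w"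
        using w by (intro Un_le) (auto simp: u disjoint meet_left meet_comm[of L "d r"])
      moreover have "\<Union>{{r<..}, {..<s}} = UNIV" using r by auto
      ultimately have "\<top> \<sqsubseteq> w" using fD(2) by simp
      then have "d r \<sqsubseteq> w" using w(1) le_trans[of "d r" \<top> w] by (simp add: top_higher)
      then have "d r \<sqinter> d r \<sqsubseteq> f {..<s}" using w(2) by simp
      then show "d r \<sqsubseteq> f {..<s}"
        using meet_le[of "d r" "d r" "d r"] le_trans[of "d r" "d r \<sqinter> d r" "f {..<s}"] by simp
    qed simp
  qed simp_all
  have box: "f {r<..<s} = box r s" for r s
  proof -
    have "{r<..<s} = {r<..} \<inter> {..<s}" by auto
    then show ?thesis by (simp add: fD(3) u d)
  qed
  have "f U = cut_map U" if U: "open U" for U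
  proof -
    let ?\<U> = "{{r<..<s} | r s. {r<..<s} \<subseteq> U}"
    have "f U = f (\<Union>?\<U>)" using open_eq_Union_intervals[OF U] by simp
    also have "\<dots> = \<Squnion>(f ` ?\<U>)" by (rule fD(4)) auto
    also have "f ` ?\<U> = {f {r<..<s} | r s. {r<..<s} \<subseteq> U}" by blast
    also have "\<dots> = {box r s | r s. {r<..<s} \<subseteq> U}" by (simp only: box)
    finally show ?thesis using U by (simp add: cut_map_def)
  qed
  then show ?thesis
    using fD(1) PiE_ext[of f _ _ cut_map] frame_realsD(1)[OF cut_map_frame_reals] by blast
qed

end

text \<open>Each cut axiom is checked at one stage that is late enough for the lower value to be
  stable. The index \<open>Suc (nat \<lceil>s\<rceil>)\<close> only has to be at least 1 and at
  least \<open>s\<close>: \<open>nat\<close> sends negative ceilings to 0, and \<open>Suc\<close>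
  then keeps the index positive.\<close>

lemma real_cut_of_truncates:
  fixes L (structure) and U D :: "nat \<Rightarrow> real \<Rightarrow> 'a"
  assumes cut: "\<And>n. 1 \<le> n \<Longrightarrow> real_cut L (U n) (D n)"
    and mono: "\<And>n r. 1 \<le> n \<Longrightarrow> U n r \<sqsubseteq> U (Suc n) r"
    and trunc: "\<And>n s. \<lbrakk>1 \<le> n; s \<le> real n\<rbrakk> \<Longrightarrow> D (Suc n) s = D n s"
    and top: "\<Squnion>{D n (real n) | n. 1 \<le> n} = \<top>"
  shows "real_cut L (\<lambda>r. \<Squnion>{U n r | n. 1 \<le> n}) (\<lambda>s. D (Suc (nat \<lceil>s\<rceil>)) s)"
proof -
  interpret one: real_cut L "U 1" "D 1" by (rule cut) simp
  let ?N = "\<lambda>s. Suc (nat \<lceil>s\<rceil>)"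
  define u where "u r = \<Squnion>{U n r | n. 1 \<le> n}" for r
  define d where "d s = D (?N s) s" for s
  have U [simp]: "U n r \<in> carrier L" and D [simp]: "D n r \<in> carrier L" if "1 \<le> n" for n r
    using real_cut.u_closed[OF cut[OF that]] real_cut.d_closed[OF cut[OF that]] by auto
  have sub: "{U n r | n. 1 \<le> n} \<subseteq> carrier L" for r using U by auto
  have u_closed [simp]: "u r \<in> carrier L" for r using sub by (simp add: u_def)
  have d_closed [simp]: "d s \<in> carrier L" for s by (simp add: d_def)
  have U_mono: "U m r \<sqsubseteq> U n r" if "m \<le> n" "1 \<le> m" for m n r
    using that(1)
  proof (induction rule: dec_induct)
    case (step n)
    then show ?case using mono[of n r] one.le_trans[of "U m r" "U n r" "U (Suc n) r"] that by simp
  qed (use that in simp)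
  have D_const: "D n s = D m s" if "m \<le> n" "1 \<le> m" "s \<le> real m" for m n s
    using that(1)
  proof (induction rule: dec_induct)
    case (step n)
    then show ?case using trunc[of n s] that by simp
  qed simp
  have N: "s \<le> real (?N s)" "1 \<le> ?N s" for s by linarith+
  have d: "D n s = d s" if "1 \<le> n" "s \<le> real n" for n s
    using D_const[of n "max n (?N s)" s] D_const[of "?N s" "max n (?N s)" s] that N[of s]
    by (simp add: d_def)
  have U_le: "U n r \<sqsubseteq> u r" if "1 \<le> n" for n r
    unfolding u_def using sub that by (intro one.sup_upper) auto
  have u_le: "u r \<sqsubseteq> y" if "\<And>n. 1 \<le> n \<Longrightarrow> U n r \<sqsubseteq> y" "y \<in> carrier L" for r y
    unfolding u_def using sub that by (intro one.sup_least) auto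
  have U_le_of: "U n r \<sqsubseteq> y" if "u r \<sqsubseteq> y" "1 \<le> n" "y \<in> carrier L" for n r y
    using one.le_trans[OF U_le that(1)] that by simp
  have "real_cut L u d"
  proof (unfold_locales, goal_cases)
    case (3 s r)
    have "d s \<sqinter> U n r \<sqsubseteq> \<bottom>" if n: "1 \<le> n" for n
    proof -
      \<comment> \<open>A common stage: the upper value has only grown since \<open>n\<close>, and
        the lower value at \<open>s\<close> is already the final one, so disjointness of this single
        cut suffices.\<close>
      let ?m = "max n (?N s)"
      have "U ?m r \<sqinter> D ?m s = \<bottom>" using 3 by (intro real_cut.disjoint[OF cut]) auto
      moreover have "d s = D ?m s" using N[of s] by (intro d[symmetric]) auto
      moreover have "d s \<sqinter> U n r \<sqsubseteq> U ?m r \<sqinter> d s"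
        using n U_mono[of n ?m r] one.le_trans[OF one.meet_right, of "d s" "U n r" "U ?m r"]
        by (intro one.meet_le) (auto simp: one.meet_left)
      ultimately show ?thesis by simp
    qed
    then have "d s \<sqinter> u r \<sqsubseteq> \<bottom>" unfolding u_def using sub by (intro one.meet_sup_le) auto
    then show ?case using one.le_antisym[of "d s \<sqinter> u r" \<bottom>] by (simp add: meet_comm)
  next
    case (4 r s y)
    then show ?case
      using real_cut.cover[OF cut, of "?N s" r s y] U_le_of[of r y "?N s"] by (simp add: d_def)
  next
    case (5 r s)
    then have "U n s \<sqsubseteq> u r" if "1 \<le> n" for n
      using that real_cut.u_antimono[OF cut[OF that] 5] one.le_trans[OF _ U_le[OF that], of "U n s" r]
      by simp
    then show ?case by (intro u_le) auto
  next
    case (6 r s)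
    then show ?case
      using real_cut.d_mono[OF cut 6, of "?N s"] d[of "?N s" r] N[of s] by (simp add: d_def)
  next
    case (7 r y)
    have "U n r \<sqsubseteq> y" if n: "1 \<le> n" for n
      by (rule real_cut.u_approx[OF cut[OF n]]) (use 7 U_le_of[OF _ n] in auto)
    then show ?case using 7 by (intro u_le) auto
  next
    case (8 s y)
    have "D (?N s) r \<sqsubseteq> y" if "r < s" for r
      using 8(1)[OF that] d[of "?N s" r] N[of s] that by simp
    then show ?case unfolding d_def using 8(2) real_cut.d_approx[OF cut, of "?N s" s y] by simp
  next
    case (9 y)
    have "U 1 r \<sqsubseteq> y" for r using 9 U_le_of[of r y 1] by simp
    then show ?case using one.u_top[of y] 9(2) by blast
  next
    case (10 y)
    have "D n (real n) \<sqsubseteq> y" if "1 \<le> n" for n using 10(1)[of "real n"] d[OF that, of "real n"] by simp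
    then have "\<Squnion>{D n (real n) | n. 1 \<le> n} \<sqsubseteq> y"
      using 10(2) by (intro one.sup_least) auto
    then show ?case using top 10 one.le_antisym[of y \<top>] by (simp add: one.top_higher)
  qed simp_all
  then show ?thesis unfolding u_def d_def .
qed

section \<open>Lattice-ordered group calculus\<close>

context W_object
begin

abbreviation vplus (infixl "\<^bold>+" 65) where "x \<^bold>+ y \<equiv> gplus G x y"
abbreviation vminus (infixl "\<^bold>-" 65) where "x \<^bold>- y \<equiv> gminus G x y"
abbreviation neg where "neg x \<equiv> inv\<^bsub>add_group G\<^esub> x"
abbreviation vzero ("\<^bold>0") where "\<^bold>0 \<equiv> gzero G"
abbreviation vunit ("\<^bold>1") where "\<^bold>1 \<equiv> gunit G"
abbreviation vscale (infixr "\<^bold>*" 75) where "k \<^bold>* x \<equiv> zmult G k x"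
abbreviation pp where "pp x \<equiv> pos_part G x"


lemma vplus_closed [simp, intro]: "x \<in> carrier G \<Longrightarrow> y \<in> carrier G \<Longrightarrow> x \<^bold>+ y \<in> carrier G"
  using add.m_closed by simp

lemma vzero_closed [simp, intro]: "\<^bold>0 \<in> carrier G"
  using add.one_closed by simp

lemma vneg_closed [simp, intro]: "x \<in> carrier G \<Longrightarrow> neg x \<in> carrier G"
  using add.inv_closed by simp

lemma vminus_closed [simp, intro]: "x \<in> carrier G \<Longrightarrow> y \<in> carrier G \<Longrightarrow> x \<^bold>- y \<in> carrier G"
  by (simp add: gminus_def)

lemma vscale_closed [simp, intro]: "x \<in> carrier G \<Longrightarrow> k \<^bold>* x \<in> carrier G"
  using add.int_pow_closed by (simp add: zmult_def)

lemma pos_part_closed [simp, intro]: "x \<in> carrier G \<Longrightarrow> pp x \<in> carrier G"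
  by (simp add: pos_part_def)

declare unit_closed [simp, intro] unit_nonneg [simp]

lemma vplus_assoc: "\<lbrakk>x \<in> carrier G; y \<in> carrier G; z \<in> carrier G\<rbrakk> \<Longrightarrow> (x \<^bold>+ y) \<^bold>+ z = x \<^bold>+ (y \<^bold>+ z)"
  using add.m_assoc by simp

lemma vplus_commute: "\<lbrakk>x \<in> carrier G; y \<in> carrier G\<rbrakk> \<Longrightarrow> x \<^bold>+ y = y \<^bold>+ x"
  using add.m_comm by simp

lemma vplus_left_commute: "\<lbrakk>x \<in> carrier G; y \<in> carrier G; z \<in> carrier G\<rbrakk> \<Longrightarrow> x \<^bold>+ (y \<^bold>+ z) = y \<^bold>+ (x \<^bold>+ z)"
  using add.m_lcomm by simp

lemma vplus_zero [simp]:
  "x \<in> carrier G \<Longrightarrow> \<^bold>0 \<^bold>+ x = x" "x \<in> carrier G \<Longrightarrow> x \<^bold>+ \<^bold>0 = x"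
  using add.l_one add.r_one by simp_all

lemma vneg_cancel:
  "x \<in> carrier G \<Longrightarrow> neg x \<^bold>+ x = \<^bold>0" "x \<in> carrier G \<Longrightarrow> x \<^bold>+ neg x = \<^bold>0"
  using add.l_inv add.r_inv by simp_all

lemma vneg_cancel_left:
  assumes "x \<in> carrier G" "y \<in> carrier G"
  shows "x \<^bold>+ (neg x \<^bold>+ y) = y" "neg x \<^bold>+ (x \<^bold>+ y) = y"
  using assms by (simp_all add: vneg_cancel flip: vplus_assoc)

lemma vneg_simps [simp]:
  "x \<in> carrier G \<Longrightarrow> neg (neg x) = x" "neg \<^bold>0 = \<^bold>0"
  using add.inv_inv add.inv_one by simp_all

lemma vneg_vplus: "\<lbrakk>x \<in> carrier G; y \<in> carrier G\<rbrakk> \<Longrightarrow> neg (x \<^bold>+ y) = neg x \<^bold>+ neg y"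
  using add.inv_mult by simp

text \<open>Set up for normalising identities of commutative groups. The closure rules for
  multiples, joins, meets and positive parts allow such terms to act as atoms.\<close>

lemmas group_simprules [algebra W_object "gzero G" "gplus G" "m_inv (add_group G)" "gminus G"] =
  vplus_closed vzero_closed vneg_closed vminus_closed vplus_assoc vplus_commute vplus_left_commute
  vplus_zero vneg_cancel vneg_cancel_left vneg_simps vneg_vplus gminus_def
  vscale_closed join_closed meet_closed pos_part_closed unit_closed


lemma vplus_le_cancel_left [simp]:
  assumes "a \<in> carrier G" "b \<in> carrier G" "c \<in> carrier G"
  shows "c \<^bold>+ a \<sqsubseteq> c \<^bold>+ b \<longleftrightarrow> a \<sqsubseteq> b"
proof
  assume "c \<^bold>+ a \<sqsubseteq> c \<^bold>+ b"
  then have "neg c \<^bold>+ (c \<^bold>+ a) \<sqsubseteq> neg c \<^bold>+ (c \<^bold>+ b)" using assms by (simp add: translation)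
  then show "a \<sqsubseteq> b" using assms by (simp add: vneg_cancel_left)
qed (use assms translation in auto)

lemma vplus_mono:
  assumes "a \<sqsubseteq> b" "c \<sqsubseteq> d" "a \<in> carrier G" "b \<in> carrier G" "c \<in> carrier G" "d \<in> carrier G"
  shows "a \<^bold>+ c \<sqsubseteq> b \<^bold>+ d"
proof -
  have "a \<^bold>+ c \<sqsubseteq> a \<^bold>+ d" using assms by simp
  also have "a \<^bold>+ d = d \<^bold>+ a" using assms by (simp add: vplus_commute)
  also have "d \<^bold>+ a \<sqsubseteq> d \<^bold>+ b" using assms by simp
  also have "d \<^bold>+ b = b \<^bold>+ d" using assms by (simp add: vplus_commute)
  finally show ?thesis using assms by simp
qed

lemma vminus_le_iff:
  assumes "a \<in> carrier G" "b \<in> carrier G" "c \<in> carrier G"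
  shows "a \<^bold>- b \<sqsubseteq> c \<longleftrightarrow> a \<sqsubseteq> b \<^bold>+ c"
proof -
  have "b \<^bold>+ (a \<^bold>- b) = a" using assms by algebra
  then show ?thesis using vplus_le_cancel_left[of "a \<^bold>- b" c b] assms by simp
qed

lemma le_vminus_iff:
  assumes "a \<in> carrier G" "b \<in> carrier G" "c \<in> carrier G"
  shows "a \<sqsubseteq> b \<^bold>- c \<longleftrightarrow> c \<^bold>+ a \<sqsubseteq> b"
proof -
  have "c \<^bold>+ (b \<^bold>- c) = b" using assms by algebra
  then show ?thesis using vplus_le_cancel_left[of a "b \<^bold>- c" c] assms by simp
qed

lemma vneg_le_iff:
  assumes "a \<in> carrier G" "b \<in> carrier G"
  shows "neg a \<sqsubseteq> neg b \<longleftrightarrow> b \<sqsubseteq> a"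
proof -
  have "(a \<^bold>+ b) \<^bold>+ neg a = b" "(a \<^bold>+ b) \<^bold>+ neg b = a" using assms by algebra+
  then show ?thesis using vplus_le_cancel_left[of "neg a" "neg b" "a \<^bold>+ b"] assms by simp
qed

lemma vplus_join:
  assumes "a \<in> carrier G" "b \<in> carrier G" "c \<in> carrier G"
  shows "c \<^bold>+ (a \<squnion> b) = (c \<^bold>+ a) \<squnion> (c \<^bold>+ b)"
proof (rule le_antisym)
  have "a \<squnion> b \<sqsubseteq> ((c \<^bold>+ a) \<squnion> (c \<^bold>+ b)) \<^bold>- c"
    using assms by (intro join_le) (simp_all add: le_vminus_iff join_left join_right)
  then show "c \<^bold>+ (a \<squnion> b) \<sqsubseteq> (c \<^bold>+ a) \<squnion> (c \<^bold>+ b)" using assms by (simp add: le_vminus_iff)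
qed (use assms in \<open>auto intro!: join_le simp: join_left join_right\<close>)

lemma vneg_join:
  assumes "a \<in> carrier G" "b \<in> carrier G"
  shows "neg (a \<squnion> b) = neg a \<sqinter> neg b"
proof (rule le_antisym)
  have "a \<squnion> b \<sqsubseteq> neg (neg a \<sqinter> neg b)"
  proof (rule join_le)
    show "a \<sqsubseteq> neg (neg a \<sqinter> neg b)"
      using vneg_le_iff[of a "neg (neg a \<sqinter> neg b)"] meet_left[of "neg a" "neg b"] assms
        vneg_le_iff[of "neg (neg a \<sqinter> neg b)" a] by simp
    show "b \<sqsubseteq> neg (neg a \<sqinter> neg b)"
      using meet_right[of "neg a" "neg b"] assms vneg_le_iff[of "neg (neg a \<sqinter> neg b)" b] by simp
  qed (use assms in auto)
  then show "neg a \<sqinter> neg b \<sqsubseteq> neg (a \<squnion> b)"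
    using assms vneg_le_iff[of "neg (neg a \<sqinter> neg b)" "a \<squnion> b"] by simp
qed (use assms in \<open>auto intro!: meet_le simp: vneg_le_iff join_left join_right\<close>)

lemma vneg_meet:
  assumes "a \<in> carrier G" "b \<in> carrier G"
  shows "neg (a \<sqinter> b) = neg a \<squnion> neg b"
  using vneg_join[of "neg a" "neg b"] assms vneg_simps(1)[of "neg a \<squnion> neg b"] by simp

lemma vplus_meet:
  assumes "a \<in> carrier G" "b \<in> carrier G" "c \<in> carrier G"
  shows "c \<^bold>+ (a \<sqinter> b) = (c \<^bold>+ a) \<sqinter> (c \<^bold>+ b)"
proof -
  have "neg (c \<^bold>+ (a \<sqinter> b)) = neg ((c \<^bold>+ a) \<sqinter> (c \<^bold>+ b))"
    using assms by (simp add: vneg_vplus vneg_meet vplus_join)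
  then show ?thesis using assms vneg_simps(1) by (metis meet_closed vplus_closed)
qed

section \<open>Positive parts and disjointness\<close>

lemma pos_part_nonneg [simp]: "x \<in> carrier G \<Longrightarrow> \<^bold>0 \<sqsubseteq> pp x"
  by (simp add: pos_part_def join_right)

lemma le_pos_part: "x \<in> carrier G \<Longrightarrow> x \<sqsubseteq> pp x"
  by (simp add: pos_part_def join_left)

lemma pos_part_le: "\<lbrakk>x \<sqsubseteq> y; \<^bold>0 \<sqsubseteq> y; x \<in> carrier G; y \<in> carrier G\<rbrakk> \<Longrightarrow> pp x \<sqsubseteq> y"
  by (simp add: pos_part_def join_le)

lemma pos_part_mono: "\<lbrakk>x \<sqsubseteq> y; x \<in> carrier G; y \<in> carrier G\<rbrakk> \<Longrightarrow> pp x \<sqsubseteq> pp y"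
  by (intro pos_part_le le_trans[of x y "pp y"]) (auto simp: le_pos_part)

lemma pos_part_of_nonneg: "\<lbrakk>\<^bold>0 \<sqsubseteq> x; x \<in> carrier G\<rbrakk> \<Longrightarrow> pp x = x"
  by (intro le_antisym) (auto simp: le_pos_part pos_part_le)

lemma pos_part_eq_zero_iff: "x \<in> carrier G \<Longrightarrow> pp x = \<^bold>0 \<longleftrightarrow> x \<sqsubseteq> \<^bold>0"
  by (metis le_antisym le_pos_part le_refl pos_part_closed pos_part_le pos_part_nonneg vzero_closed)

lemma pos_part_idem [simp]: "x \<in> carrier G \<Longrightarrow> pp (pp x) = pp x"
  by (simp add: pos_part_of_nonneg)

lemma pos_part_vplus:
  assumes "x \<in> carrier G" "y \<in> carrier G"
  shows "pp (x \<^bold>+ y) \<sqsubseteq> pp x \<^bold>+ pp y"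
proof (rule pos_part_le)
  show "\<^bold>0 \<sqsubseteq> pp x \<^bold>+ pp y" using vplus_mono[of "\<^bold>0" "pp x" "\<^bold>0" "pp y"] assms by simp
qed (use assms in \<open>auto intro!: vplus_mono simp: le_pos_part\<close>)

text \<open>Translation preserves joins, so translating \<open>pp x\<close> by \<open>neg x\<close>
  yields \<open>pp (neg x)\<close>.\<close>

lemma pos_part_decomp:
  assumes "x \<in> carrier G"
  shows "x = pp x \<^bold>- pp (neg x)"
proof -
  have "neg x \<^bold>+ pp x = pp (neg x)"
    using assms by (simp add: pos_part_def vplus_join vneg_cancel join_comm)
  moreover have "x = pp x \<^bold>- (neg x \<^bold>+ pp x)" using assms by algebra
  ultimately show ?thesis by simp
qed

text \<open>The negative of \<open>pp (neg x)\<close> is the meet of \<open>x\<close> with zero.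
  Adding \<open>pp (neg x)\<close> to that meet gives zero, while distributing the sum over the meet
  gives the left-hand side.\<close>

lemma pos_part_disjoint:
  assumes "x \<in> carrier G"
  shows "pp x \<sqinter> pp (neg x) = \<^bold>0"
proof -
  have "neg (pp (neg x)) = x \<sqinter> \<^bold>0"
    using assms by (simp add: pos_part_def vneg_join)
  then have "pp (neg x) \<^bold>+ (x \<sqinter> \<^bold>0) = \<^bold>0" using assms by (metis vneg_cancel(2) vneg_closed pos_part_closed)
  moreover have "pp (neg x) \<^bold>+ x = pp x"
    using assms vplus_join[of "neg x" "\<^bold>0" x]
    by (simp add: pos_part_def vneg_cancel join_comm vplus_commute)
  ultimately show ?thesis using assms by (simp add: vplus_meet)
qed

text \<open>In general the positive part of a difference is \<open>a\<close> minus the meet of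
  \<open>b\<close> and \<open>a\<close>, and here that meet vanishes.\<close>

lemma pos_part_diff_disjoint:
  assumes "a \<sqinter> b = \<^bold>0" "a \<in> carrier G" "b \<in> carrier G"
  shows "pp (a \<^bold>- b) = a"
proof -
  have "pp (a \<^bold>- b) = (a \<^bold>+ neg b) \<squnion> (a \<^bold>+ neg a)"
    using assms by (simp add: pos_part_def gminus_def vneg_cancel)
  also have "\<dots> = a \<^bold>+ neg (b \<sqinter> a)" using assms by (simp add: vplus_join vneg_meet)
  also have "\<dots> = a" using assms by (simp add: meet_comm)
  finally show ?thesis .
qed

lemma meet_mono:
  assumes "a \<sqsubseteq> b" "c \<sqsubseteq> d" "a \<in> carrier G" "b \<in> carrier G" "c \<in> carrier G" "d \<in> carrier G"
  shows "a \<sqinter> c \<sqsubseteq> b \<sqinter> d"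
  using assms by (intro meet_le) (auto intro: le_trans[OF meet_left] le_trans[OF meet_right])

lemma meet_nonneg: "\<lbrakk>\<^bold>0 \<sqsubseteq> a; \<^bold>0 \<sqsubseteq> b; a \<in> carrier G; b \<in> carrier G\<rbrakk> \<Longrightarrow> \<^bold>0 \<sqsubseteq> a \<sqinter> b"
  by (intro meet_le) auto

text \<open>With \<open>t\<close> the left-hand side, subtracting \<open>x \<sqinter> z\<close> from
  \<open>t\<close> gives the join of \<open>t - x\<close> and \<open>t - z\<close>, and both lie
  below \<open>y \<sqinter> z\<close>. This subadditivity is what makes residuals closed under
  sums.\<close>

lemma meet_vplus_le:
  assumes nonneg: "\<^bold>0 \<sqsubseteq> x" "\<^bold>0 \<sqsubseteq> y" "\<^bold>0 \<sqsubseteq> z"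
    and [simp]: "x \<in> carrier G" "y \<in> carrier G" "z \<in> carrier G"
  shows "(x \<^bold>+ y) \<sqinter> z \<sqsubseteq> (x \<sqinter> z) \<^bold>+ (y \<sqinter> z)"
proof -
  let ?t = "(x \<^bold>+ y) \<sqinter> z"
  have tz: "?t \<sqsubseteq> z" and txy: "?t \<sqsubseteq> x \<^bold>+ y" by (simp_all add: meet_left meet_right)
  have "?t \<^bold>- z \<sqsubseteq> \<^bold>0" using tz by (simp add: vminus_le_iff)
  then have "?t \<^bold>- z \<sqsubseteq> y \<sqinter> z"
    by (rule le_trans) (simp_all add: meet_nonneg nonneg)
  moreover have "?t \<^bold>- x \<sqsubseteq> y \<sqinter> z"
  proof (rule meet_le)
    show "?t \<^bold>- x \<sqsubseteq> y" using txy by (simp add: vminus_le_iff)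
    have "\<^bold>0 \<^bold>+ ?t \<sqsubseteq> x \<^bold>+ z" using nonneg(1) tz by (intro vplus_mono) simp_all
    then show "?t \<^bold>- x \<sqsubseteq> z" by (simp add: vminus_le_iff)
  qed simp_all
  ultimately have "(?t \<^bold>- x) \<squnion> (?t \<^bold>- z) \<sqsubseteq> y \<sqinter> z" by (intro join_le) simp_all
  moreover have "(?t \<^bold>- x) \<squnion> (?t \<^bold>- z) = ?t \<^bold>- (x \<sqinter> z)"
    by (simp add: gminus_def vneg_meet vplus_join)
  ultimately show ?thesis by (simp add: vminus_le_iff)
qed

text \<open>Expresses meets through positive parts, so that \<open>vscale_meet\<close> follows from
  \<open>vscale_pos_part\<close>.\<close>

lemma meet_via_pos_part:
  assumes "a \<in> carrier G" "c \<in> carrier G"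
  shows "c \<sqinter> a = c \<^bold>- pp (c \<^bold>- a)"
proof -
  have "pp (c \<^bold>- a) = c \<^bold>+ neg (c \<sqinter> a)"
    using assms by (simp add: pos_part_def gminus_def vneg_meet vplus_join vneg_cancel join_comm)
  moreover have "c \<^bold>- (c \<^bold>+ neg (c \<sqinter> a)) = c \<sqinter> a" using assms by algebra
  ultimately show ?thesis by simp
qed

section \<open>Integer multiples and the lattice operations\<close>

lemma vscale_int_zero [simp]: "0 \<^bold>* x = \<^bold>0"
  by (simp add: zmult_def)

lemma vscale_one [simp]: "x \<in> carrier G \<Longrightarrow> 1 \<^bold>* x = x"
  using add.int_pow_1[of x] by (simp add: zmult_def)

lemma vscale_zero [simp]: "k \<^bold>* \<^bold>0 = \<^bold>0"
  using add.int_pow_one by (simp add: zmult_def)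

lemma vscale_add_left: "x \<in> carrier G \<Longrightarrow> (k + l) \<^bold>* x = k \<^bold>* x \<^bold>+ l \<^bold>* x"
  using add.int_pow_mult[of x k l] by (simp add: zmult_def)

lemma vscale_neg_left: "x \<in> carrier G \<Longrightarrow> (- k) \<^bold>* x = neg (k \<^bold>* x)"
  using add.int_pow_neg[of x k] by (simp add: zmult_def)

lemma vscale_diff_left: "x \<in> carrier G \<Longrightarrow> (k - l) \<^bold>* x = k \<^bold>* x \<^bold>- l \<^bold>* x"
  using vscale_add_left[of x k "- l"] by (simp add: vscale_neg_left gminus_def)

lemma vscale_vplus: "\<lbrakk>x \<in> carrier G; y \<in> carrier G\<rbrakk> \<Longrightarrow> k \<^bold>* (x \<^bold>+ y) = k \<^bold>* x \<^bold>+ k \<^bold>* y"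
  using add.int_pow_distrib[of x y k] by (simp add: zmult_def)

lemma vscale_vneg: "x \<in> carrier G \<Longrightarrow> k \<^bold>* neg x = neg (k \<^bold>* x)"
  using add.int_pow_inv[of x k] by (simp add: zmult_def)

lemma vscale_vminus: "\<lbrakk>x \<in> carrier G; y \<in> carrier G\<rbrakk> \<Longrightarrow> k \<^bold>* (x \<^bold>- y) = k \<^bold>* x \<^bold>- k \<^bold>* y"
  by (simp add: gminus_def vscale_vplus vscale_vneg)

lemma vscale_vscale: "x \<in> carrier G \<Longrightarrow> k \<^bold>* l \<^bold>* x = (k * l) \<^bold>* x"
  using add.int_pow_pow[of x l k] by (simp add: zmult_def mult.commute)

lemma vscale_Suc: "x \<in> carrier G \<Longrightarrow> int (Suc n) \<^bold>* x = x \<^bold>+ int n \<^bold>* x"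
  using vscale_add_left[of x 1 "int n"] by simp

lemma vscale_nonneg:
  assumes "\<^bold>0 \<sqsubseteq> x" "x \<in> carrier G" "0 \<le> k"
  shows "\<^bold>0 \<sqsubseteq> k \<^bold>* x"
proof -
  have "\<^bold>0 \<sqsubseteq> int n \<^bold>* x" for n
  proof (induction n)
    case (Suc n)
    have "\<^bold>0 \<^bold>+ \<^bold>0 \<sqsubseteq> x \<^bold>+ int n \<^bold>* x" using Suc assms by (intro vplus_mono) simp_all
    then show ?case using assms by (simp add: vscale_Suc del: of_nat_Suc)
  qed simp
  from this[of "nat k"] show ?thesis using assms by simp
qed

lemma vscale_mono:
  assumes "x \<sqsubseteq> y" "x \<in> carrier G" "y \<in> carrier G" "0 \<le> k"
  shows "k \<^bold>* x \<sqsubseteq> k \<^bold>* y"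
  using vscale_nonneg[of "y \<^bold>- x" k] assms by (simp add: vscale_vminus le_vminus_iff)

lemma vscale_mono_left:
  assumes "\<^bold>0 \<sqsubseteq> x" "x \<in> carrier G" "k \<le> l"
  shows "k \<^bold>* x \<sqsubseteq> l \<^bold>* x"
  using vscale_nonneg[of x "l - k"] assms by (simp add: vscale_diff_left le_vminus_iff)

lemma meet_vscale_le:
  assumes "\<^bold>0 \<sqsubseteq> x" "\<^bold>0 \<sqsubseteq> z" "x \<in> carrier G" "z \<in> carrier G"
  shows "int n \<^bold>* x \<sqinter> z \<sqsubseteq> int n \<^bold>* (x \<sqinter> z)"
proof (induction n)
  case 0
  then show ?case using assms meet_left[of "\<^bold>0" z] by simp
next
  case (Suc n)
  have "(x \<^bold>+ int n \<^bold>* x) \<sqinter> z \<sqsubseteq> (x \<sqinter> z) \<^bold>+ (int n \<^bold>* x \<sqinter> z)"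
    using assms by (intro meet_vplus_le) (simp_all add: vscale_nonneg)
  also have "\<dots> \<sqsubseteq> (x \<sqinter> z) \<^bold>+ int n \<^bold>* (x \<sqinter> z)" using assms Suc by simp
  finally show ?case using assms by (simp add: vscale_Suc del: of_nat_Suc)
qed

lemma vscale_disjoint:
  assumes "x \<sqinter> z = \<^bold>0" "x \<in> carrier G" "z \<in> carrier G" "0 \<le> k"
  shows "k \<^bold>* x \<sqinter> z = \<^bold>0"
proof -
  have nn: "\<^bold>0 \<sqsubseteq> x" "\<^bold>0 \<sqsubseteq> z" using assms meet_left[of x z] meet_right[of x z] by simp_all
  have "int (nat k) \<^bold>* x \<sqinter> z \<sqsubseteq> \<^bold>0"
    using meet_vscale_le[OF nn, of "nat k"] assms by simp
  then show ?thesis using nn assms by (intro le_antisym) (auto intro!: meet_nonneg vscale_nonneg)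
qed

text \<open>Multiples of disjoint elements stay disjoint. Hence scaling
  \<open>x = pp x - pp (neg x)\<close> again writes a difference of disjoint elements, and
  \<open>pos_part_diff_disjoint\<close> reads off its positive part.\<close>

lemma vscale_pos_part:
  assumes "x \<in> carrier G" "0 \<le> k"
  shows "k \<^bold>* pp x = pp (k \<^bold>* x)"
proof -
  have "k \<^bold>* pp x \<sqinter> pp (neg x) = \<^bold>0"
    using assms by (intro vscale_disjoint pos_part_disjoint) auto
  then have "k \<^bold>* pp (neg x) \<sqinter> k \<^bold>* pp x = \<^bold>0"
    using assms by (intro vscale_disjoint) (auto simp: meet_comm)
  then have "pp (k \<^bold>* pp x \<^bold>- k \<^bold>* pp (neg x)) = k \<^bold>* pp x"
    using assms by (intro pos_part_diff_disjoint) (auto simp: meet_comm)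
  then show ?thesis using assms pos_part_decomp[of x] by (simp flip: vscale_vminus)
qed

lemma vscale_meet:
  assumes "a \<in> carrier G" "c \<in> carrier G" "0 \<le> k"
  shows "k \<^bold>* (c \<sqinter> a) = k \<^bold>* c \<sqinter> k \<^bold>* a"
  using assms by (simp add: meet_via_pos_part vscale_vminus vscale_pos_part)

section \<open>W-kernels as closed convex l-subgroups\<close>

text \<open>Modulo \<open>K\<close>, \<open>x\<close> lies below \<open>y\<close> when the positive
  part of their difference is in \<open>K\<close>. Read this way, the last two clauses are the
  archimedean and weak-unit axioms of the quotient, pulled back to \<open>G\<close>.\<close>

definition W_ideal :: "'a set \<Rightarrow> bool" where
  "W_ideal K \<longleftrightarrow> K \<subseteq> carrier G \<and> \<^bold>0 \<in> K \<and> (\<forall>x\<in>K. \<forall>y\<in>K. x \<^bold>- y \<in> K) \<and> (\<forall>x\<in>K. pp x \<in> K) \<and>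
     (\<forall>y\<in>K. \<forall>x\<in>carrier G. \<^bold>0 \<sqsubseteq> x \<longrightarrow> x \<sqsubseteq> y \<longrightarrow> x \<in> K) \<and>
     (\<forall>a\<in>carrier G. \<forall>b\<in>carrier G. \<^bold>0 \<sqsubseteq> a \<longrightarrow> (\<forall>n. pp (int n \<^bold>* a \<^bold>- b) \<in> K) \<longrightarrow> a \<in> K) \<and>
     (\<forall>a\<in>carrier G. \<^bold>0 \<sqsubseteq> a \<longrightarrow> a \<sqinter> \<^bold>1 \<in> K \<longrightarrow> a \<in> K)"

lemma W_idealD:
  assumes "W_ideal K"
  shows W_ideal_subset: "K \<subseteq> carrier G"
    and W_ideal_zero: "\<^bold>0 \<in> K"
    and W_ideal_vminus: "\<And>x y. \<lbrakk>x \<in> K; y \<in> K\<rbrakk> \<Longrightarrow> x \<^bold>- y \<in> K"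
    and W_ideal_pos_part: "\<And>x. x \<in> K \<Longrightarrow> pp x \<in> K"
    and W_ideal_convex: "\<And>x y. \<lbrakk>y \<in> K; \<^bold>0 \<sqsubseteq> x; x \<sqsubseteq> y; x \<in> carrier G\<rbrakk> \<Longrightarrow> x \<in> K"
    and W_ideal_arch: "\<And>a b. \<lbrakk>\<And>n. pp (int n \<^bold>* a \<^bold>- b) \<in> K; \<^bold>0 \<sqsubseteq> a; a \<in> carrier G; b \<in> carrier G\<rbrakk> \<Longrightarrow> a \<in> K"
    and W_ideal_unit: "\<And>a. \<lbrakk>a \<sqinter> \<^bold>1 \<in> K; \<^bold>0 \<sqsubseteq> a; a \<in> carrier G\<rbrakk> \<Longrightarrow> a \<in> K"
  using assms unfolding W_ideal_def by blast+

lemma W_ideal_vneg: "\<lbrakk>W_ideal K; x \<in> K\<rbrakk> \<Longrightarrow> neg x \<in> K"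
  using W_ideal_vminus[of K "\<^bold>0" x] W_ideal_zero[of K] W_ideal_subset[of K]
  by (auto simp: gminus_def subset_iff)

lemma W_ideal_vplus:
  assumes "W_ideal K" "x \<in> K" "y \<in> K"
  shows "x \<^bold>+ y \<in> K"
  using W_ideal_vminus[OF assms(1,2) W_ideal_vneg[OF assms(1,3)]] W_ideal_subset[OF assms(1)] assms
  by (auto simp: gminus_def subset_iff)

lemma W_ideal_vscale:
  assumes "W_ideal K" "x \<in> K" "0 \<le> k"
  shows "k \<^bold>* x \<in> K"
proof -
  have "x \<in> carrier G" using W_ideal_subset assms by blast
  then have "int n \<^bold>* x \<in> K" for n
    by (induction n) (use assms in \<open>auto simp: vscale_Suc W_ideal_zero W_ideal_vplus simp del: of_nat_Suc\<close>)
  from this[of "nat k"] show ?thesis using assms by simp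
qed

lemma W_ideal_pos_part_le:
  assumes "W_ideal K" "pp x \<in> K" "y \<sqsubseteq> x" "x \<in> carrier G" "y \<in> carrier G"
  shows "pp y \<in> K"
  using W_ideal_convex[OF assms(1,2)] assms by (simp add: pos_part_mono)

lemma W_ideal_pos_part_vplus:
  assumes "W_ideal K" "pp x \<in> K" "pp y \<in> K" "x \<in> carrier G" "y \<in> carrier G"
  shows "pp (x \<^bold>+ y) \<in> K"
  using W_ideal_convex[OF assms(1) W_ideal_vplus[OF assms(1-3)]] assms by (simp add: pos_part_vplus)

lemma W_ideal_iff_pos_parts:
  assumes "W_ideal K" "x \<in> carrier G"
  shows "x \<in> K \<longleftrightarrow> pp x \<in> K \<and> pp (neg x) \<in> K"
  using W_ideal_pos_part[OF assms(1)] W_ideal_vneg[OF assms(1)]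
    W_ideal_vminus[OF assms(1), of "pp x" "pp (neg x)"] pos_part_decomp[OF assms(2)] by auto

text \<open>Permits clearing denominators: \<open>pp x\<close> lies below its positive multiples,
  and a W-ideal is convex.\<close>

lemma W_ideal_pos_part_vscale_iff:
  assumes "W_ideal K" "x \<in> carrier G" "0 < k"
  shows "pp (k \<^bold>* x) \<in> K \<longleftrightarrow> pp x \<in> K"
proof
  assume "pp (k \<^bold>* x) \<in> K"
  moreover have "pp x \<sqsubseteq> pp (k \<^bold>* x)"
    using vscale_mono_left[of "pp x" 1 k] assms by (simp flip: vscale_pos_part)
  ultimately show "pp x \<in> K" using assms by (auto intro: W_ideal_convex)
qed (use assms W_ideal_vscale in \<open>auto simp flip: vscale_pos_part\<close>)

lemma W_ideal_carrier: "W_ideal (carrier G)"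
  by (simp add: W_ideal_def)

lemma W_ideal_Inter:
  assumes "\<And>K. K \<in> \<A> \<Longrightarrow> W_ideal K"
  shows "W_ideal (carrier G \<inter> \<Inter>\<A>)"
  unfolding W_ideal_def
proof (intro conjI ballI allI impI)
  fix a b assume "a \<in> carrier G" "b \<in> carrier G" "\<^bold>0 \<sqsubseteq> a"
    "\<forall>n. pp (int n \<^bold>* a \<^bold>- b) \<in> carrier G \<inter> \<Inter>\<A>"
  then show "a \<in> carrier G \<inter> \<Inter>\<A>" using W_ideal_arch[OF assms, of _ a b] by auto
next
  fix x y assume "y \<in> carrier G \<inter> \<Inter>\<A>" "x \<in> carrier G" "\<^bold>0 \<sqsubseteq> x" "x \<sqsubseteq> y"
  then show "x \<in> carrier G \<inter> \<Inter>\<A>" using W_ideal_convex[OF assms, of _ y x] by auto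
next
  fix a assume "a \<in> carrier G" "\<^bold>0 \<sqsubseteq> a" "a \<sqinter> \<^bold>1 \<in> carrier G \<inter> \<Inter>\<A>"
  then show "a \<in> carrier G \<inter> \<Inter>\<A>" using W_ideal_unit[OF assms, of _ a] by auto
next
  fix x assume x: "x \<in> carrier G \<inter> \<Inter>\<A>"
  then show "pp x \<in> carrier G \<inter> \<Inter>\<A>" using W_ideal_pos_part[OF assms, of _ x] by auto
  fix y assume "y \<in> carrier G \<inter> \<Inter>\<A>"
  then show "x \<^bold>- y \<in> carrier G \<inter> \<Inter>\<A>" using x W_ideal_vminus[OF assms, of _ x y] by auto
qed (use W_ideal_zero[OF assms] in auto)

text \<open>For this set the last two closure clauses are exactly the archimedean and weak-unit
  axioms of \<open>G\<close>. It becomes the bottom of the Madden frame.\<close>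

lemma W_ideal_singleton_zero: "W_ideal {\<^bold>0}"
  unfolding W_ideal_def
proof (intro conjI ballI allI impI)
  fix x y assume "y \<in> {\<^bold>0}" "x \<in> carrier G" "\<^bold>0 \<sqsubseteq> x" "x \<sqsubseteq> y"
  then show "x \<in> {\<^bold>0}" using le_antisym[of x "\<^bold>0"] by simp
next
  fix a b assume *: "a \<in> carrier G" "b \<in> carrier G" "\<^bold>0 \<sqsubseteq> a" "\<forall>n. pp (int n \<^bold>* a \<^bold>- b) \<in> {\<^bold>0}"
  then have "int n \<^bold>* a \<sqsubseteq> b" for n by (simp add: pos_part_eq_zero_iff vminus_le_iff)
  then show "a \<in> {\<^bold>0}" using archimedean[of a b] * by simp
qed (auto simp: pos_part_of_nonneg gminus_def weak_unit)

text \<open>The residual \<open>c \<rightarrow> J\<close>; its existence makes the lattice of W-kernels distributive.\<close>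

lemma W_ideal_residual:
  assumes J: "W_ideal J" and c: "\<^bold>0 \<sqsubseteq> c" "c \<in> carrier G"
  shows "W_ideal {x \<in> carrier G. pp x \<sqinter> c \<in> J \<and> pp (neg x) \<sqinter> c \<in> J}" (is "W_ideal ?R")
proof -
  have sub: "pp (x \<^bold>+ y) \<sqinter> c \<in> J"
    if "pp x \<sqinter> c \<in> J" "pp y \<sqinter> c \<in> J" and [simp]: "x \<in> carrier G" "y \<in> carrier G" for x y
  proof -
    have "pp (x \<^bold>+ y) \<sqinter> c \<sqsubseteq> (pp x \<^bold>+ pp y) \<sqinter> c" using c by (intro meet_mono) (auto simp: pos_part_vplus)
    also have "\<dots> \<sqsubseteq> (pp x \<sqinter> c) \<^bold>+ (pp y \<sqinter> c)" using c by (intro meet_vplus_le) auto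
    finally show ?thesis using c that
      by (intro W_ideal_convex[OF J W_ideal_vplus[OF J that(1,2)]]) (auto intro: meet_nonneg)
  qed
  have zero: "\<^bold>0 \<sqinter> c = \<^bold>0" using c by (intro le_antisym) (auto simp: meet_left meet_nonneg)
  have z: "pp \<^bold>0 = \<^bold>0" by (simp add: pos_part_of_nonneg)
  have np: "pp (neg x) = \<^bold>0" if "\<^bold>0 \<sqsubseteq> x" "x \<in> carrier G" for x
    using that vneg_le_iff[of x "\<^bold>0"] by (simp add: pos_part_eq_zero_iff)
  \<comment> \<open>The negative part of a nonnegative element vanishes, so only the first condition
    remains.\<close>
  have pos: "x \<in> ?R \<longleftrightarrow> x \<sqinter> c \<in> J" if "\<^bold>0 \<sqsubseteq> x" "x \<in> carrier G" for x
    using that by (simp add: pos_part_of_nonneg np zero W_ideal_zero[OF J])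
  show ?thesis
    unfolding W_ideal_def
  proof (intro conjI ballI allI impI)
    show "\<^bold>0 \<in> ?R" using pos[of "\<^bold>0"] zero W_ideal_zero[OF J] by simp
    fix x assume x: "x \<in> ?R"
    show "pp x \<in> ?R" using x pos[of "pp x"] by simp
    fix y assume y: "y \<in> ?R"
    have "neg (x \<^bold>- y) = y \<^bold>+ neg x" using x y by simp algebra
    then show "x \<^bold>- y \<in> ?R" using x y sub[of x "neg y"] sub[of y "neg x"] by (simp add: gminus_def)
  next
    fix x y assume *: "y \<in> ?R" "x \<in> carrier G" "\<^bold>0 \<sqsubseteq> x" "x \<sqsubseteq> y"
    then have "\<^bold>0 \<sqsubseteq> y" "y \<in> carrier G" using le_trans[of "\<^bold>0" x y] by auto
    moreover from this have "x \<sqinter> c \<in> J"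
      using * pos[of y] c by (intro W_ideal_convex[OF J, of "y \<sqinter> c" "x \<sqinter> c"]) (auto intro: meet_mono meet_nonneg)
    ultimately show "x \<in> ?R" using * pos by simp
  next
    fix a b assume a: "a \<in> carrier G" and b: "b \<in> carrier G" and nn: "\<^bold>0 \<sqsubseteq> a"
      and "\<forall>n. pp (int n \<^bold>* a \<^bold>- b) \<in> ?R"
    then have n: "pp (int n \<^bold>* a \<^bold>- b) \<sqinter> c \<in> J" for n by simp
    \<comment> \<open>Replacing \<open>b\<close> by \<open>pp b\<close> keeps \<open>?y\<close>
      below \<open>n\<close> times \<open>?u\<close>; it also lies below \<open>?x\<close>.
      \<open>meet_vscale_le\<close> then bounds it by \<open>n\<close> times
      \<open>?u \<sqinter> ?x\<close>, hence by \<open>n\<close> times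
      \<open>?x \<sqinter> c\<close>, which belongs to \<open>J\<close>.\<close>
    have "pp (int n \<^bold>* (a \<sqinter> c) \<^bold>- pp b) \<in> J" for n
    proof -
      let ?y = "pp (int n \<^bold>* (a \<sqinter> c) \<^bold>- pp b)" and ?u = "a \<sqinter> c" and ?x = "pp (int n \<^bold>* a \<^bold>- b)"
      have u: "\<^bold>0 \<sqsubseteq> ?u" using nn c a by (intro meet_nonneg)
      have nu: "\<^bold>0 \<sqsubseteq> int n \<^bold>* ?u" using u a c by (intro vscale_nonneg) auto
      have "int n \<^bold>* ?u \<sqsubseteq> pp b \<^bold>+ int n \<^bold>* ?u"
        using vplus_mono[of "\<^bold>0" "pp b" "int n \<^bold>* ?u" "int n \<^bold>* ?u"] a b c by simp
      then have y_le: "?y \<sqsubseteq> int n \<^bold>* ?u"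
        using a b c nu by (intro pos_part_le) (simp_all add: vminus_le_iff)
      have "int n \<^bold>* ?u \<sqsubseteq> b \<^bold>+ (int n \<^bold>* a \<^bold>- b)"
      proof -
        have "b \<^bold>+ (int n \<^bold>* a \<^bold>- b) = int n \<^bold>* a" using a b by algebra
        then show ?thesis using a c by (simp add: vscale_mono meet_left)
      qed
      also have "\<dots> \<sqsubseteq> pp b \<^bold>+ (int n \<^bold>* a \<^bold>- b)" using a b by (intro vplus_mono) (auto simp: le_pos_part)
      finally have y_le_x: "?y \<sqsubseteq> ?x"
        using a b c by (intro pos_part_mono) (simp_all add: vminus_le_iff)
      have "?y \<sqsubseteq> int n \<^bold>* ?u \<sqinter> ?x" using y_le y_le_x a b c by (intro meet_le) auto
      also have "\<dots> \<sqsubseteq> int n \<^bold>* (?u \<sqinter> ?x)" using u a b c by (intro meet_vscale_le) auto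
      also have "\<dots> \<sqsubseteq> int n \<^bold>* (?x \<sqinter> c)"
      proof (rule vscale_mono)
        show "?u \<sqinter> ?x \<sqsubseteq> ?x \<sqinter> c"
          using a b c meet_mono[of ?u c ?x ?x] by (simp add: meet_right meet_comm)
      qed (use a b c in auto)
      finally show ?thesis
        using a b c n W_ideal_vscale[OF J n] by (intro W_ideal_convex[OF J, of "int n \<^bold>* (?x \<sqinter> c)" ?y]) auto
    qed
    then have "a \<sqinter> c \<in> J"
      using W_ideal_arch[OF J, of "a \<sqinter> c" "pp b"] a b c nn by (simp add: meet_nonneg)
    then show "a \<in> ?R" using pos nn a by simp
  next
    fix a assume a: "a \<in> carrier G" and nn: "\<^bold>0 \<sqsubseteq> a" and "a \<sqinter> \<^bold>1 \<in> ?R"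
    then have "(a \<sqinter> \<^bold>1) \<sqinter> c \<in> J" using pos[of "a \<sqinter> \<^bold>1"] by (simp add: meet_nonneg)
    moreover have "(a \<sqinter> \<^bold>1) \<sqinter> c = (a \<sqinter> c) \<sqinter> \<^bold>1" using a c by (metis meet_assoc meet_comm unit_closed)
    ultimately show "a \<in> ?R" using pos[of a] a nn c W_ideal_unit[OF J, of "a \<sqinter> c"] by (simp add: meet_nonneg)
  qed auto
qed

end

section \<open>Kernels are W-ideals, and quotients by W-ideals are W-objects\<close>

lemma W_ideal_kernel:
  assumes "W_object G" "W_object H" and \<phi>: "W_morphism G H \<phi>"
  shows "W_object.W_ideal G (kernel (add_group G) (add_group H) \<phi>)"
proof -
  interpret G: W_object G by fact
  interpret H: W_object H by fact
  have hom: "\<phi> \<in> hom (add_group G) (add_group H)"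
    and join: "\<And>x y. x \<in> carrier G \<Longrightarrow> y \<in> carrier G \<Longrightarrow> \<phi> (x \<squnion>\<^bsub>G\<^esub> y) = \<phi> x \<squnion>\<^bsub>H\<^esub> \<phi> y"
    and meet: "\<And>x y. x \<in> carrier G \<Longrightarrow> y \<in> carrier G \<Longrightarrow> \<phi> (x \<sqinter>\<^bsub>G\<^esub> y) = \<phi> x \<sqinter>\<^bsub>H\<^esub> \<phi> y"
    and unit: "\<phi> (gunit G) = gunit H"
    using \<phi> by (simp_all add: W_morphism_def join_pres_def meet_pres_def)
  interpret \<phi>: group_hom "add_group G" "add_group H" \<phi>
    using hom by unfold_locales auto
  have cl: "\<And>x. x \<in> carrier G \<Longrightarrow> \<phi> x \<in> carrier H" using \<phi>.hom_closed by simp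
  have zero: "\<phi> (gzero G) = gzero H" using \<phi>.hom_one by simp
  have minus: "\<And>x y. x \<in> carrier G \<Longrightarrow> y \<in> carrier G \<Longrightarrow> \<phi> (gminus G x y) = gminus H (\<phi> x) (\<phi> y)"
    using \<phi>.hom_mult \<phi>.hom_inv by (simp add: gminus_def)
  have pos: "\<And>x. x \<in> carrier G \<Longrightarrow> \<phi> (pos_part G x) = pos_part H (\<phi> x)"
    by (simp add: pos_part_def join zero)
  have scale: "\<And>x k. x \<in> carrier G \<Longrightarrow> \<phi> (zmult G k x) = zmult H k (\<phi> x)"
    using \<phi>.hom_int_pow by (simp add: zmult_def)
  have le: "\<phi> x \<sqsubseteq>\<^bsub>H\<^esub> \<phi> y" if "x \<sqsubseteq>\<^bsub>G\<^esub> y" "x \<in> carrier G" "y \<in> carrier G" for x y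
    using join[of x y] H.join_left[of "\<phi> x" "\<phi> y"] that cl by (simp add: G.le_iff_meet)
  have ker: "x \<in> kernel (add_group G) (add_group H) \<phi> \<longleftrightarrow> x \<in> carrier G \<and> \<phi> x = gzero H" for x
    by (simp add: kernel_def)
  show ?thesis
    unfolding G.W_ideal_def
  proof (intro conjI ballI allI impI)
    fix x y
    assume "y \<in> kernel (add_group G) (add_group H) \<phi>" "x \<in> carrier G" "gzero G \<sqsubseteq>\<^bsub>G\<^esub> x" "x \<sqsubseteq>\<^bsub>G\<^esub> y"
    then show "x \<in> kernel (add_group G) (add_group H) \<phi>"
      using le[of x y] le[of "gzero G" x] cl[of x] H.le_antisym[of "\<phi> x" "gzero H"] zero by (simp add: ker)
  next
    fix a b assume *: "a \<in> carrier G" "b \<in> carrier G" "gzero G \<sqsubseteq>\<^bsub>G\<^esub> a"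
      "\<forall>n. pos_part G (gminus G (zmult G (int n) a) b) \<in> kernel (add_group G) (add_group H) \<phi>"
    then have "zmult H (int n) (\<phi> a) \<sqsubseteq>\<^bsub>H\<^esub> \<phi> b" for n
      by (simp add: ker pos minus scale cl H.pos_part_eq_zero_iff H.vminus_le_iff)
    then show "a \<in> kernel (add_group G) (add_group H) \<phi>"
      using * H.archimedean[of "\<phi> a" "\<phi> b"] le[of "gzero G" a] zero cl by (simp add: ker)
  next
    fix a assume "a \<in> carrier G" "gzero G \<sqsubseteq>\<^bsub>G\<^esub> a" "a \<sqinter>\<^bsub>G\<^esub> gunit G \<in> kernel (add_group G) (add_group H) \<phi>"
    then show "a \<in> kernel (add_group G) (add_group H) \<phi>"
      using H.weak_unit[of "\<phi> a"] le[of "gzero G" a] cl by (simp add: ker zero meet unit)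
    next
    fix x y
    assume "x \<in> kernel (add_group G) (add_group H) \<phi>" "y \<in> kernel (add_group G) (add_group H) \<phi>"
    moreover have "gminus H (gzero H) (gzero H) = gzero H" by (simp add: gminus_def)
    ultimately show "gminus G x y \<in> kernel (add_group G) (add_group H) \<phi>" by (simp add: ker minus)
  qed (auto simp: ker zero pos H.pos_part_of_nonneg)
qed

context W_object
begin

definition quotient_class :: "'a set \<Rightarrow> 'a \<Rightarrow> 'a set" where
  "quotient_class K x = {y \<in> carrier G. y \<^bold>- x \<in> K}"

text \<open>Cosets ordered by \<open>pp (x - y) \<in> K\<close>. Quantifying over all
  representatives in \<open>le\<close> and uniting over them in \<open>gplus\<close> avoids choosing
  any; \<open>quotient_le_iff\<close> and \<open>quotient_plus\<close> show independence of the
  representatives.\<close>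

definition quotient :: "'a set \<Rightarrow> 'a set wgroup" where
  "quotient K = \<lparr>carrier = quotient_class K ` carrier G, eq = (=),
     le = (\<lambda>A B. \<forall>x\<in>A. \<forall>y\<in>B. pp (x \<^bold>- y) \<in> K),
     gplus = (\<lambda>A B. \<Union>x\<in>A. \<Union>y\<in>B. quotient_class K (x \<^bold>+ y)),
     gzero = quotient_class K \<^bold>0, gunit = quotient_class K \<^bold>1\<rparr>"

lemma quotient_class_self: "\<lbrakk>W_ideal K; x \<in> carrier G\<rbrakk> \<Longrightarrow> x \<in> quotient_class K x"
  by (simp add: quotient_class_def gminus_def vneg_cancel W_ideal_zero)

lemma quotient_class_eq_iff:
  assumes K: "W_ideal K" and [simp]: "x \<in> carrier G" "y \<in> carrier G"
  shows "quotient_class K x = quotient_class K y \<longleftrightarrow> x \<^bold>- y \<in> K"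
proof
  assume "quotient_class K x = quotient_class K y"
  moreover have "x \<in> quotient_class K x" by (simp add: quotient_class_self[OF K])
  ultimately show "x \<^bold>- y \<in> K" by (simp add: quotient_class_def)
next
  assume xy: "x \<^bold>- y \<in> K"
  have "z \<^bold>- x = (z \<^bold>- y) \<^bold>- (x \<^bold>- y)" "z \<^bold>- y = (z \<^bold>- x) \<^bold>+ (x \<^bold>- y)"
    if "z \<in> carrier G" for z using that assms by algebra+
  then show "quotient_class K x = quotient_class K y"
    unfolding quotient_class_def using W_ideal_vminus[OF K _ xy] W_ideal_vplus[OF K _ xy] by metis
qed

lemma quotient_le_iff:
  assumes K: "W_ideal K" and [simp]: "x \<in> carrier G" "y \<in> carrier G"
  shows "quotient_class K x \<sqsubseteq>\<^bsub>quotient K\<^esub> quotient_class K y \<longleftrightarrow> pp (x \<^bold>- y) \<in> K"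
proof
  have "x \<in> quotient_class K x" "y \<in> quotient_class K y" by (simp_all add: quotient_class_self[OF K])
  moreover assume "quotient_class K x \<sqsubseteq>\<^bsub>quotient K\<^esub> quotient_class K y"
  ultimately show "pp (x \<^bold>- y) \<in> K" by (simp add: quotient_def)
next
  assume xy: "pp (x \<^bold>- y) \<in> K"
  have "pp (a \<^bold>- b) \<in> K" if [simp]: "a \<in> carrier G" "b \<in> carrier G" and "a \<^bold>- x \<in> K" "b \<^bold>- y \<in> K" for a b
  proof -
    have "a \<^bold>- b = (x \<^bold>- y) \<^bold>+ ((a \<^bold>- x) \<^bold>- (b \<^bold>- y))"
      using that assms by algebra
    moreover have "pp ((a \<^bold>- x) \<^bold>- (b \<^bold>- y)) \<in> K"
      using that W_ideal_vminus[OF K] W_ideal_pos_part[OF K] by simp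
    ultimately show ?thesis using W_ideal_pos_part_vplus[OF K xy] by simp
  qed
  then show "quotient_class K x \<sqsubseteq>\<^bsub>quotient K\<^esub> quotient_class K y"
    by (simp add: quotient_def quotient_class_def)
qed

lemma quotient_plus:
  assumes K: "W_ideal K" and [simp]: "x \<in> carrier G" "y \<in> carrier G"
  shows "gplus (quotient K) (quotient_class K x) (quotient_class K y) = quotient_class K (x \<^bold>+ y)"
proof -
  have eq: "quotient_class K (a \<^bold>+ b) = quotient_class K (x \<^bold>+ y)"
    if "a \<in> quotient_class K x" "b \<in> quotient_class K y" for a b
  proof -
    have *: "a \<in> carrier G" "b \<in> carrier G" "a \<^bold>- x \<in> K" "b \<^bold>- y \<in> K"
      using that by (auto simp: quotient_class_def)
    then have "(a \<^bold>+ b) \<^bold>- (x \<^bold>+ y) = (a \<^bold>- x) \<^bold>+ (b \<^bold>- y)" using assms by algebra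
    then show ?thesis using * W_ideal_vplus[OF K *(3,4)] by (simp add: quotient_class_eq_iff[OF K])
  qed
  have ne: "quotient_class K x \<noteq> {}" "quotient_class K y \<noteq> {}"
    using quotient_class_self[OF K assms(2)] quotient_class_self[OF K assms(3)] by auto
  have "(\<Union>a\<in>quotient_class K x. \<Union>b\<in>quotient_class K y. quotient_class K (a \<^bold>+ b)) =
      (\<Union>a\<in>quotient_class K x. \<Union>b\<in>quotient_class K y. quotient_class K (x \<^bold>+ y))"
    by (rule SUP_cong[OF HOL.refl], rule SUP_cong[OF HOL.refl], rule eq)
  then show ?thesis using ne by (simp add: quotient_def)
qed

text \<open>Both elements lie below \<open>pp x\<close> plus \<open>pp y\<close>, which is
  nonnegative and in \<open>K\<close>. Modulo \<open>K\<close>: if \<open>x\<close> and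
  \<open>y\<close> are at most zero, so is their join. This gives suprema in the quotient and, after
  negation, infima.\<close>

lemma W_ideal_pos_part_join:
  assumes K: "W_ideal K" "pp x \<in> K" "pp y \<in> K" and [simp]: "x \<in> carrier G" "y \<in> carrier G"
  shows "pp (x \<squnion> y) \<in> K"
proof -
  have nn: "\<^bold>0 \<sqsubseteq> pp x \<^bold>+ pp y" using vplus_mono[of "\<^bold>0" "pp x" "\<^bold>0" "pp y"] by simp
  have "x \<sqsubseteq> pp x \<^bold>+ pp y" using vplus_mono[of x "pp x" "\<^bold>0" "pp y"] by (simp add: le_pos_part)
  moreover have "y \<sqsubseteq> pp x \<^bold>+ pp y" using vplus_mono[of "\<^bold>0" "pp x" y "pp y"] by (simp add: le_pos_part)
  ultimately have "pp (x \<squnion> y) \<sqsubseteq> pp x \<^bold>+ pp y" using nn by (simp add: pos_part_le join_le)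
  then show ?thesis by (intro W_ideal_convex[OF K(1) W_ideal_vplus[OF K]]) auto
qed

lemma quotient_simps:
  "carrier (quotient K) = quotient_class K ` carrier G" "eq (quotient K) = (=)"
  "gzero (quotient K) = quotient_class K \<^bold>0" "gunit (quotient K) = quotient_class K \<^bold>1"
  by (simp_all add: quotient_def)

lemma vminus_join:
  assumes "x \<in> carrier G" "y \<in> carrier G" "z \<in> carrier G"
  shows "(x \<squnion> y) \<^bold>- z = (x \<^bold>- z) \<squnion> (y \<^bold>- z)"
  using assms vplus_join[of x y "neg z"] by (simp add: gminus_def vplus_commute)

lemma vminus_meet_right:
  assumes "x \<in> carrier G" "y \<in> carrier G" "z \<in> carrier G"
  shows "z \<^bold>- (x \<sqinter> y) = (z \<^bold>- x) \<squnion> (z \<^bold>- y)"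
  using assms by (simp add: gminus_def vneg_meet vplus_join)

lemma quotient_le_of_le:
  assumes "W_ideal K" "x \<sqsubseteq> y" "x \<in> carrier G" "y \<in> carrier G"
  shows "pp (x \<^bold>- y) \<in> K"
proof -
  have "pp (x \<^bold>- y) = \<^bold>0" using assms by (simp add: pos_part_eq_zero_iff vminus_le_iff)
  then show ?thesis using W_ideal_zero[OF assms(1)] by simp
qed

lemma quotient_lattice:
  assumes K: "W_ideal K"
  shows "lattice (quotient K)"
    and "\<And>x y. \<lbrakk>x \<in> carrier G; y \<in> carrier G\<rbrakk> \<Longrightarrow>
      quotient_class K x \<squnion>\<^bsub>quotient K\<^esub> quotient_class K y = quotient_class K (x \<squnion> y)"
    and "\<And>x y. \<lbrakk>x \<in> carrier G; y \<in> carrier G\<rbrakk> \<Longrightarrow>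
      quotient_class K x \<sqinter>\<^bsub>quotient K\<^esub> quotient_class K y = quotient_class K (x \<sqinter> y)"
proof -
  note simps = quotient_simps quotient_le_iff[OF K] quotient_class_eq_iff[OF K]
  interpret Q: partial_order "quotient K"
  proof (unfold_locales, goal_cases)
    case (2 A) then show ?case using W_ideal_zero[OF K] quotient_le_of_le[OF K] by (auto simp: simps)
  next
    case (5 A B)
    then obtain x y where xy: "x \<in> carrier G" "y \<in> carrier G"
      "A = quotient_class K x" "B = quotient_class K y"
      by (auto simp: quotient_simps)
    with 5 have *: "x \<in> carrier G" "y \<in> carrier G"
      "A = quotient_class K x" "B = quotient_class K y" "pp (x \<^bold>- y) \<in> K" "pp (y \<^bold>- x) \<in> K"
      by (simp_all add: simps)
    moreover have "neg (x \<^bold>- y) = y \<^bold>- x" using *(1,2) by algebra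
    ultimately show ?case using W_ideal_iff_pos_parts[OF K, of "x \<^bold>- y"] by (simp add: simps)
  next
    case (6 A B C)
    then obtain x y z where xyz: "x \<in> carrier G" "y \<in> carrier G" "z \<in> carrier G"
      "A = quotient_class K x" "B = quotient_class K y" "C = quotient_class K z"
      by (auto simp: quotient_simps)
    with 6 have *: "x \<in> carrier G" "y \<in> carrier G" "z \<in> carrier G"
      "A = quotient_class K x" "B = quotient_class K y" "C = quotient_class K z"
      "pp (x \<^bold>- y) \<in> K" "pp (y \<^bold>- z) \<in> K"
      by (simp_all add: simps)
    have "(x \<^bold>- y) \<^bold>+ (y \<^bold>- z) = x \<^bold>- z" using *(1-3) by algebra
    then show ?case using W_ideal_pos_part_vplus[OF K *(7,8)] * by (simp add: simps)
  qed (use quotient_le_of_le[OF K] in \<open>auto simp: simps\<close>)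
  have sup: "least (quotient K) (quotient_class K (x \<squnion> y))
      (Upper (quotient K) {quotient_class K x, quotient_class K y})"
    if [simp]: "x \<in> carrier G" "y \<in> carrier G" for x y
  proof (rule least_UpperI)
    fix A assume "A \<in> {quotient_class K x, quotient_class K y}"
    then show "A \<sqsubseteq>\<^bsub>quotient K\<^esub> quotient_class K (x \<squnion> y)"
      using quotient_le_of_le[OF K] by (auto simp: simps join_left join_right)
  next
    fix A assume A: "A \<in> Upper (quotient K) {quotient_class K x, quotient_class K y}"
    then obtain z where z: "z \<in> carrier G" "A = quotient_class K z" by (auto simp: Upper_def quotient_simps)
    from A have "quotient_class K x \<sqsubseteq>\<^bsub>quotient K\<^esub> A" "quotient_class K y \<sqsubseteq>\<^bsub>quotient K\<^esub> A"
      by (auto simp: Upper_def quotient_simps)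
    with z show "quotient_class K (x \<squnion> y) \<sqsubseteq>\<^bsub>quotient K\<^esub> A"
      using W_ideal_pos_part_join[OF K, of "x \<^bold>- z" "y \<^bold>- z"]
      by (simp add: quotient_le_iff[OF K] vminus_join)
  qed (auto simp: simps)
  have inf: "greatest (quotient K) (quotient_class K (x \<sqinter> y))
      (Lower (quotient K) {quotient_class K x, quotient_class K y})"
    if [simp]: "x \<in> carrier G" "y \<in> carrier G" for x y
  proof (rule greatest_LowerI)
    fix A assume "A \<in> {quotient_class K x, quotient_class K y}"
    then show "quotient_class K (x \<sqinter> y) \<sqsubseteq>\<^bsub>quotient K\<^esub> A"
      using quotient_le_of_le[OF K] by (auto simp: simps meet_left meet_right)
  next
    fix A assume A: "A \<in> Lower (quotient K) {quotient_class K x, quotient_class K y}"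
    then obtain z where z: "z \<in> carrier G" "A = quotient_class K z" by (auto simp: Lower_def quotient_simps)
    from A have "A \<sqsubseteq>\<^bsub>quotient K\<^esub> quotient_class K x" "A \<sqsubseteq>\<^bsub>quotient K\<^esub> quotient_class K y"
      by (auto simp: Lower_def quotient_simps)
    with z show "A \<sqsubseteq>\<^bsub>quotient K\<^esub> quotient_class K (x \<sqinter> y)"
      using W_ideal_pos_part_join[OF K, of "z \<^bold>- x" "z \<^bold>- y"]
      by (simp add: quotient_le_iff[OF K] vminus_meet_right)
  qed (auto simp: simps)
  show "lattice (quotient K)"
    by unfold_locales (use sup inf in \<open>force simp: simps\<close>)+
  then interpret Q: lattice "quotient K" .
  fix x y assume xy: "x \<in> carrier G" "y \<in> carrier G"
  show "quotient_class K x \<squnion>\<^bsub>quotient K\<^esub> quotient_class K y = quotient_class K (x \<squnion> y)"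
    by (rule Q.joinI) (use xy Q.least_unique[OF _ sup[OF xy]] in \<open>auto simp: simps\<close>)
  show "quotient_class K x \<sqinter>\<^bsub>quotient K\<^esub> quotient_class K y = quotient_class K (x \<sqinter> y)"
    by (rule Q.meetI) (use xy Q.greatest_unique[OF _ inf[OF xy]] in \<open>auto simp: simps\<close>)
qed

lemma W_object_quotient:
  assumes K: "W_ideal K"
  shows "W_object (quotient K)"
proof -
  note simps = quotient_simps quotient_le_iff[OF K] quotient_class_eq_iff[OF K] quotient_plus[OF K]
  note lat = quotient_lattice[OF K]
  have cg: "comm_group (add_group (quotient K))"
  proof (rule comm_groupI, goal_cases)
    case (6 A)
    then obtain x where "x \<in> carrier G" "A = quotient_class K x" by (auto simp: simps)
    then show ?case using W_ideal_zero[OF K]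
      by (auto simp: simps vneg_cancel gminus_def intro!: bexI[of _ "neg x"])
  qed (auto simp: simps vplus_assoc vplus_commute vplus_left_commute)
  have scale: "zmult (quotient K) (int n) (quotient_class K x) = quotient_class K (int n \<^bold>* x)"
    if "x \<in> carrier G" for n x
    unfolding zmult_def int_pow_int
    by (induction n) (use that add.nat_pow_closed[of x] in \<open>simp_all add: simps\<close>)
  show ?thesis
  proof (intro W_object.intro lat(1) cg W_object_axioms.intro, goal_cases)
    case (1 A B C)
    then obtain x y z where xyz: "x \<in> carrier G" "y \<in> carrier G" "z \<in> carrier G"
      "A = quotient_class K x" "B = quotient_class K y" "C = quotient_class K z"
      by (auto simp: quotient_simps)
    with 1 have *: "x \<in> carrier G" "y \<in> carrier G" "z \<in> carrier G"
      "A = quotient_class K x" "B = quotient_class K y" "C = quotient_class K z" "pp (x \<^bold>- y) \<in> K"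
      by (simp_all add: simps)
    have "(z \<^bold>+ x) \<^bold>- (z \<^bold>+ y) = x \<^bold>- y" using *(1-3) by algebra
    then show ?case using * by (simp add: simps)
  next
    case (2 A B)
    then obtain a b where ab: "a \<in> carrier G" "b \<in> carrier G" "A = quotient_class K a"
      "B = quotient_class K b"
      by (auto simp: quotient_simps)
    with 2 have *: "a \<in> carrier G" "b \<in> carrier G" "A = quotient_class K a"
      "B = quotient_class K b" "pp (neg a) \<in> K" "\<And>n. pp (int n \<^bold>* a \<^bold>- b) \<in> K"
      by (simp_all add: simps scale) (simp add: gminus_def)
    \<comment> \<open>In the quotient \<open>a\<close> is nonnegative only modulo \<open>K\<close>,
      whereas \<open>W_ideal_arch\<close> wants an element that is nonnegative in \<open>G\<close>.
      So \<open>a\<close> is replaced by \<open>pp a\<close>, which differs from it by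
      \<open>pp (neg a) \<in> K\<close>.\<close>
    have "pp (int n \<^bold>* pp a \<^bold>- b) \<in> K" for n
    proof -
      have "a \<^bold>+ pp (neg a) = pp a"
      proof -
        have "a \<^bold>+ pp (neg a) = (pp a \<^bold>- pp (neg a)) \<^bold>+ pp (neg a)"
          using pos_part_decomp[OF *(1)] by simp
        also have "\<dots> = pp a" using *(1) by algebra
        finally show ?thesis .
      qed
      then have "int n \<^bold>* pp a = int n \<^bold>* a \<^bold>+ int n \<^bold>* pp (neg a)"
        using * by (metis vscale_vplus pos_part_closed vneg_closed)
      then have "int n \<^bold>* pp a \<^bold>- b = (int n \<^bold>* a \<^bold>- b) \<^bold>+ int n \<^bold>* pp (neg a)"
        using *(1,2) by simp algebra
      moreover have "pp (int n \<^bold>* pp (neg a)) \<in> K"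
        using * W_ideal_pos_part[OF K W_ideal_vscale[OF K]] by simp
      ultimately show ?thesis using W_ideal_pos_part_vplus[OF K *(6)] * by simp
    qed
    then have "pp a \<in> K" using W_ideal_arch[OF K, of "pp a" b] * by simp
    then have "a \<in> K" using W_ideal_iff_pos_parts[OF K *(1)] * by simp
    then show ?case using * by (simp add: simps gminus_def)
  next
    case 3 then show ?case by (simp add: simps)
  next
    case 4 then show ?case using quotient_le_of_le[OF K] by (simp add: simps)
  next
    case (5 A)
    then obtain a where a: "a \<in> carrier G" "A = quotient_class K a" by (auto simp: quotient_simps)
    with 5 have "pp (\<^bold>0 \<^bold>- a) \<in> K" "(a \<sqinter> \<^bold>1) \<^bold>- \<^bold>0 \<in> K" by (simp_all add: simps lat)
    with a have *: "a \<in> carrier G" "A = quotient_class K a" "pp (neg a) \<in> K" "a \<sqinter> \<^bold>1 \<in> K"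
      by (simp_all add: gminus_def)
    \<comment> \<open>The correction term once more: \<open>pp a\<close> is \<open>a\<close> shifted
      by \<open>?k \<in> K\<close>, and since \<open>?k\<close> is nonnegative, the meet of
      \<open>pp a\<close> with the unit is at most \<open>?k\<close> plus the meet of
      \<open>a\<close> with the unit.\<close>
    let ?k = "pp (neg a)"
    have "pp a = ?k \<^bold>+ a"
    proof -
      have "?k \<^bold>+ a = ?k \<^bold>+ (pp a \<^bold>- ?k)" using pos_part_decomp[OF *(1)] by simp
      also have "\<dots> = pp a" using *(1) by algebra
      finally show ?thesis by simp
    qed
    moreover have "\<^bold>0 \<^bold>+ \<^bold>1 \<sqsubseteq> ?k \<^bold>+ \<^bold>1" using * by (intro vplus_mono) auto
    ultimately have "pp a \<sqinter> \<^bold>1 \<sqsubseteq> (?k \<^bold>+ a) \<sqinter> (?k \<^bold>+ \<^bold>1)"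
      using * by (intro meet_mono) auto
    also have "\<dots> = ?k \<^bold>+ (a \<sqinter> \<^bold>1)" using * by (simp add: vplus_meet)
    finally have "pp a \<sqinter> \<^bold>1 \<in> K"
      using * by (intro W_ideal_convex[OF K W_ideal_vplus[OF K *(3,4)]]) (auto intro: meet_nonneg)
    then have "pp a \<in> K" using W_ideal_unit[OF K, of "pp a"] * by simp
    then have "a \<in> K" using W_ideal_iff_pos_parts[OF K *(1)] * by simp
    then show ?case using * by (simp add: simps gminus_def)
  qed
qed

theorem W_kernel_iff_W_ideal: "W_kernel G K \<longleftrightarrow> W_ideal K"
proof
  assume "W_kernel G K"
  then show "W_ideal K" unfolding W_kernel_def using W_ideal_kernel W_object_axioms by blast
next
  assume K: "W_ideal K"
  note lat = quotient_lattice[OF K]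
  have "W_morphism G (quotient K) (quotient_class K)"
    unfolding W_morphism_def join_pres_def meet_pres_def hom_def
    using lattice_axioms lat by (auto simp: quotient_simps quotient_plus[OF K])
  moreover have "K = kernel (add_group G) (add_group (quotient K)) (quotient_class K)"
  proof -
    have "quotient_class K x = quotient_class K \<^bold>0 \<longleftrightarrow> x \<in> K" if "x \<in> carrier G" for x
      using that by (simp add: quotient_class_eq_iff[OF K] gminus_def)
    then show ?thesis using W_ideal_subset[OF K] by (auto simp: kernel_def quotient_simps)
  qed
  ultimately show "W_kernel G K"
    using W_kernelI[OF W_object_axioms W_object_quotient[OF K], of "quotient_class K"] by simp
qed

section \<open>The Madden frame and the Madden representation\<close>

lemma W_ideal_generated:
  assumes "S \<subseteq> carrier G"
  shows "W_ideal (W_kernel_generated G S)"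
proof -
  have "W_kernel_generated G S = carrier G \<inter> \<Inter>{K. W_ideal K \<and> S \<subseteq> K}"
    unfolding W_kernel_generated_def hull_def W_kernel_iff_W_ideal using assms W_ideal_carrier by auto
  then show ?thesis using W_ideal_Inter[of "{K. W_ideal K \<and> S \<subseteq> K}"] by simp
qed

lemma generated_subset_iff: "W_ideal K \<Longrightarrow> W_kernel_generated G S \<subseteq> K \<longleftrightarrow> S \<subseteq> K"
  unfolding W_kernel_generated_def by (rule subset_hull) (simp add: W_kernel_iff_W_ideal)

lemma generated_inc: "x \<in> S \<Longrightarrow> x \<in> W_kernel_generated G S"
  unfolding W_kernel_generated_def by (rule hull_inc)

text \<open>The meet of \<open>pp x\<close> with the unit is in \<open>K\<close> by convexity, and
  the weak-unit clause then puts \<open>pp x\<close> itself in \<open>K\<close>. Every proof that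
  some W-ideal is top ends here.\<close>

lemma W_ideal_eq_carrier:
  assumes "W_ideal K" "\<^bold>1 \<in> K"
  shows "K = carrier G"
proof -
  have "pp x \<in> K" if "x \<in> carrier G" for x
  proof -
    have "pp x \<sqinter> \<^bold>1 \<in> K"
      using W_ideal_convex[OF assms, of "pp x \<sqinter> \<^bold>1"] that by (simp add: meet_nonneg meet_right)
    then show ?thesis using W_ideal_unit[OF assms(1), of "pp x"] that by simp
  qed
  then show ?thesis using W_ideal_iff_pos_parts[OF assms(1)] W_ideal_subset[OF assms(1)] by blast
qed

lemma madden_frame_simps [simp]:
  "carrier (madden_frame G) = {K. W_ideal K}" "le (madden_frame G) = (\<subseteq>)" "eq (madden_frame G) = (=)"
  by (simp_all add: madden_frame_def W_kernel_iff_W_ideal)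

lemma madden_frame_complete_lattice: "complete_lattice (madden_frame G)"
proof -
  interpret M: partial_order "madden_frame G" by unfold_locales auto
  show ?thesis
  proof (unfold_locales, goal_cases)
    case (1 \<A>)
    then have "\<Union>\<A> \<subseteq> carrier G" using W_ideal_subset by auto
    note gen = W_ideal_generated[OF this]
    have "least (madden_frame G) (W_kernel_generated G (\<Union>\<A>)) (Upper (madden_frame G) \<A>)"
      using 1 gen generated_inc[of _ "\<Union>\<A>"] by (auto simp: least_def Upper_def generated_subset_iff)
    then show ?case ..
  next
    case (2 \<A>)
    then have "W_ideal (carrier G \<inter> \<Inter>\<A>)" by (intro W_ideal_Inter) auto
    then have "greatest (madden_frame G) (carrier G \<inter> \<Inter>\<A>) (Lower (madden_frame G) \<A>)"
      using 2 W_ideal_subset by (fastforce simp: greatest_def Lower_def)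
    then show ?case ..
  qed
qed

interpretation M: complete_lattice "madden_frame G"
  by (rule madden_frame_complete_lattice)

lemma madden_meet:
  assumes "W_ideal I" "W_ideal J"
  shows "I \<sqinter>\<^bsub>madden_frame G\<^esub> J = I \<inter> J"
proof -
  have "W_ideal (carrier G \<inter> \<Inter>{I, J})" using assms by (intro W_ideal_Inter) auto
  moreover have "carrier G \<inter> \<Inter>{I, J} = I \<inter> J" using W_ideal_subset[OF assms(1)] by auto
  ultimately have "W_ideal (I \<inter> J)" by simp
  then show ?thesis
    using assms M.meet_le[of "I \<inter> J" I J] M.meet_left[of I J] M.meet_right[of I J] by auto
qed

lemma madden_bottom: "\<bottom>\<^bsub>madden_frame G\<^esub> = {\<^bold>0}"
  using M.bottom_lower[of "{\<^bold>0}"] W_ideal_singleton_zero M.bottom_closed W_ideal_zero by auto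

lemma madden_top: "\<top>\<^bsub>madden_frame G\<^esub> = carrier G"
  using M.top_higher[of "carrier G"] W_ideal_carrier M.top_closed W_ideal_subset by auto

text \<open>For \<open>x\<close> in \<open>I\<close> and in the join, the residual of
  \<open>J\<close> by \<open>pp x\<close> is a W-ideal containing every member of the family, hence
  the join. So it contains \<open>x\<close>, and \<open>pp x\<close>, met with itself, is in
  \<open>J\<close>; negative parts follow by passing to \<open>neg x\<close>.\<close>

lemma madden_frame_frame: "frame (madden_frame G)"
proof (intro frame.intro madden_frame_complete_lattice frame_axioms.intro)
  fix I \<A> J
  assume I: "I \<in> carrier (madden_frame G)" and \<A>: "\<A> \<subseteq> carrier (madden_frame G)"
    and J: "J \<in> carrier (madden_frame G)"
    and le: "\<And>A. A \<in> \<A> \<Longrightarrow> I \<sqinter>\<^bsub>madden_frame G\<^esub> A \<sqsubseteq>\<^bsub>madden_frame G\<^esub> J"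
  have le: "I \<inter> A \<subseteq> J" if "A \<in> \<A>" for A using le[OF that] madden_meet[of I A] I \<A> that by auto
  let ?S = "\<Squnion>\<^bsub>madden_frame G\<^esub> \<A>"
  have S: "W_ideal ?S" using M.sup_closed[OF \<A>] by simp
  have "pp x \<in> J" if x: "x \<in> I" "x \<in> ?S" for x
  proof -
    have xG: "x \<in> carrier G" using x I W_ideal_subset by auto
    have px: "pp x \<in> I" using W_ideal_pos_part x I by auto
    let ?R = "{y \<in> carrier G. pp y \<sqinter> pp x \<in> J \<and> pp (neg y) \<sqinter> pp x \<in> J}"
    have R: "W_ideal ?R" using J xG by (intro W_ideal_residual) auto
    have "A \<subseteq> ?R" if A: "A \<in> \<A>" for A
    proof
      have AI: "W_ideal A" using A \<A> by auto
      have *: "pp y \<sqinter> pp x \<in> J" if "y \<in> A" for y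
      proof -
        have y: "y \<in> carrier G" "pp y \<in> A" using that AI W_ideal_subset W_ideal_pos_part by auto
        have "pp y \<sqinter> pp x \<in> A"
          using W_ideal_convex[OF AI y(2), of "pp y \<sqinter> pp x"] y xG by (simp add: meet_nonneg meet_left)
        moreover have "pp y \<sqinter> pp x \<in> I"
          using W_ideal_convex[OF _ px, of "pp y \<sqinter> pp x"] I y xG by (simp add: meet_nonneg meet_right)
        ultimately show ?thesis using le[OF A] by auto
      qed
      fix y assume "y \<in> A"
      then show "y \<in> ?R" using * W_ideal_vneg[OF AI] W_ideal_subset[OF AI] by auto
    qed
    then have "?S \<subseteq> ?R" using M.sup_least[OF \<A>, of ?R] R by simp
    then have "pp x \<sqinter> pp x \<in> J" using x by auto
    moreover have "pp x \<sqinter> pp x = pp x" using xG by (intro le_antisym) (auto intro: meet_le meet_left)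
    ultimately show ?thesis by simp
  qed
  then have "x \<in> J" if "x \<in> I" "x \<in> ?S" for x
    using that W_ideal_vneg[OF S] W_ideal_vneg[of I] I J W_ideal_iff_pos_parts[of J x] W_ideal_subset[of I] by auto
  then show "I \<sqinter>\<^bsub>madden_frame G\<^esub> ?S \<sqsubseteq>\<^bsub>madden_frame G\<^esub> J"
    using madden_meet[of I ?S] I S by auto
qed

text \<open>Elements disjoint from a fixed one form a residual of the zero ideal, so disjointness
  from one \<open>b \<in> T\<close> passes from \<open>S\<close> to all it generates. Repeating this
  with the roles exchanged makes a common element disjoint from itself.\<close>

lemma generated_disjoint:
  assumes S: "S \<subseteq> carrier G" "\<And>a. a \<in> S \<Longrightarrow> \<^bold>0 \<sqsubseteq> a" and T: "T \<subseteq> carrier G" "\<And>b. b \<in> T \<Longrightarrow> \<^bold>0 \<sqsubseteq> b"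
    and disj: "\<And>a b. \<lbrakk>a \<in> S; b \<in> T\<rbrakk> \<Longrightarrow> a \<sqinter> b = \<^bold>0"
  shows "W_kernel_generated G S \<inter> W_kernel_generated G T = {\<^bold>0}"
proof -
  let ?R = "\<lambda>c. {x \<in> carrier G. pp x \<sqinter> c \<in> {\<^bold>0} \<and> pp (neg x) \<sqinter> c \<in> {\<^bold>0}}"
  have R: "W_ideal (?R c)" if "\<^bold>0 \<sqsubseteq> c" "c \<in> carrier G" for c
    using that by (intro W_ideal_residual W_ideal_singleton_zero)
  have mem: "x \<in> ?R c" if "x \<sqinter> c = \<^bold>0" "\<^bold>0 \<sqsubseteq> x" "\<^bold>0 \<sqsubseteq> c" "x \<in> carrier G" "c \<in> carrier G" for x c
  proof -
    have "pp (neg x) = \<^bold>0" using that vneg_le_iff[of x "\<^bold>0"] by (simp add: pos_part_eq_zero_iff)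
    moreover have "\<^bold>0 \<sqinter> c = \<^bold>0" using that by (intro le_antisym) (auto simp: meet_left meet_nonneg)
    ultimately show ?thesis using that by (simp add: pos_part_of_nonneg)
  qed
  note gS = W_ideal_generated[OF S(1)] and gT = W_ideal_generated[OF T(1)]
  have ST: "pp x \<sqinter> b = \<^bold>0" if x: "x \<in> W_kernel_generated G S" and b: "b \<in> T" for x b
  proof -
    have "S \<subseteq> ?R b"
    proof
      fix a assume "a \<in> S"
      then show "a \<in> ?R b" using S T b disj by (intro mem) auto
    qed
    then have "W_kernel_generated G S \<subseteq> ?R b" using R[of b] T b by (subst generated_subset_iff) auto
    then show ?thesis using x by auto
  qed
  have zero: "pp x = \<^bold>0" if x: "x \<in> W_kernel_generated G S" "x \<in> W_kernel_generated G T" for x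
  proof -
    have xG: "x \<in> carrier G" using x W_ideal_subset[OF gS] by auto
    have "T \<subseteq> ?R (pp x)"
    proof
      fix b assume "b \<in> T"
      then show "b \<in> ?R (pp x)" using ST[OF x(1), of b] T xG by (intro mem) (auto simp: meet_comm)
    qed
    then have "W_kernel_generated G T \<subseteq> ?R (pp x)" using R[of "pp x"] xG by (subst generated_subset_iff) auto
    then have "pp x \<sqinter> pp x = \<^bold>0" using x by auto
    moreover have "pp x \<sqinter> pp x = pp x" using xG by (intro le_antisym) (auto intro: meet_le meet_left)
    ultimately show ?thesis by simp
  qed
  have "x = \<^bold>0" if x: "x \<in> W_kernel_generated G S" "x \<in> W_kernel_generated G T" for x
  proof -
    have "x \<in> carrier G" using x W_ideal_subset[OF gS] by auto
    moreover have "pp x = \<^bold>0" "pp (neg x) = \<^bold>0"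
      using zero x W_ideal_vneg[OF gS] W_ideal_vneg[OF gT] by auto
    ultimately have "x = \<^bold>0 \<^bold>- \<^bold>0" using pos_part_decomp[of x] by metis
    then show ?thesis by (simp add: gminus_def)
  qed
  then show ?thesis using W_ideal_zero[OF gS] W_ideal_zero[OF gT] by blast
qed

text \<open>One formula for rational and irrational \<open>r\<close>. The strict inequality makes
  approximation from the right automatic; agreement with the single generator prescribed at a
  rational is \<open>upper_kernel_rational\<close>.\<close>

definition upper_kernel :: "'a \<Rightarrow> real \<Rightarrow> 'a set" where
  "upper_kernel x r = W_kernel_generated G
     {pp (q \<^bold>* x \<^bold>- p \<^bold>* \<^bold>1) | p q. 0 < q \<and> r < of_int p / of_int q}"

lemma upper_kernel_W_ideal [simp]: "x \<in> carrier G \<Longrightarrow> W_ideal (upper_kernel x r)"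
  unfolding upper_kernel_def by (rule W_ideal_generated) auto

lemma upper_kernel_subset_iff:
  "W_ideal K \<Longrightarrow> upper_kernel x r \<subseteq> K \<longleftrightarrow>
     (\<forall>p q. 0 < q \<longrightarrow> r < of_int p / of_int q \<longrightarrow> pp (q \<^bold>* x \<^bold>- p \<^bold>* \<^bold>1) \<in> K)"
  unfolding upper_kernel_def by (auto simp: generated_subset_iff)

lemma upper_kernel_mem:
  "\<lbrakk>0 < q; r < of_int p / of_int q\<rbrakk> \<Longrightarrow> pp (q \<^bold>* x \<^bold>- p \<^bold>* \<^bold>1) \<in> upper_kernel x r"
  unfolding upper_kernel_def by (rule generated_inc) auto

lemma vscale_affine:
  "x \<in> carrier G \<Longrightarrow> k \<^bold>* (q \<^bold>* x \<^bold>- p \<^bold>* \<^bold>1) = (k * q) \<^bold>* x \<^bold>- (k * p) \<^bold>* \<^bold>1"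
  by (simp add: vscale_vminus vscale_vscale)

lemma vminus_mono:
  assumes "a \<sqsubseteq> b" "d \<sqsubseteq> c" "a \<in> carrier G" "b \<in> carrier G" "c \<in> carrier G" "d \<in> carrier G"
  shows "a \<^bold>- c \<sqsubseteq> b \<^bold>- d"
  using assms by (simp add: gminus_def vplus_mono vneg_le_iff)

text \<open>The hypothesis \<open>le\<close> is \<open>p/q \<le> p'/q'\<close> with denominators
  cleared. Scaling both elements to the common coefficient \<open>q q'\<close> of \<open>x\<close>
  makes them comparable.\<close>

lemma affine_compare:
  assumes K: "W_ideal K" and x: "x \<in> carrier G" and q: "0 < q" "0 < q'"
    and le: "p * q' \<le> p' * q" and mem: "pp (q \<^bold>* x \<^bold>- p \<^bold>* \<^bold>1) \<in> K"
  shows "pp (q' \<^bold>* x \<^bold>- p' \<^bold>* \<^bold>1) \<in> K"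
proof -
  have "q \<^bold>* (q' \<^bold>* x \<^bold>- p' \<^bold>* \<^bold>1) \<sqsubseteq> q' \<^bold>* (q \<^bold>* x \<^bold>- p \<^bold>* \<^bold>1)"
    using x le vscale_mono_left[of "\<^bold>1" "q' * p" "q * p'"]
    by (simp add: vscale_affine mult.commute vminus_mono)
  moreover have "pp (q' \<^bold>* (q \<^bold>* x \<^bold>- p \<^bold>* \<^bold>1)) \<in> K"
    using mem q x by (simp add: W_ideal_pos_part_vscale_iff[OF K])
  ultimately have "pp (q \<^bold>* (q' \<^bold>* x \<^bold>- p' \<^bold>* \<^bold>1)) \<in> K"
    using W_ideal_pos_part_le[OF K] x by simp
  then show ?thesis using q x by (simp add: W_ideal_pos_part_vscale_iff[OF K])
qed

text \<open>The generator at \<open>p/q\<close> itself is not among those defining the left-hand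
  side. It is recovered by the archimedean clause with the unit as bound, from generators at
  rationals slightly above \<open>p/q\<close>.\<close>

lemma upper_kernel_rational:
  assumes x: "x \<in> carrier G" and q: "0 < q"
  shows "upper_kernel x (of_int p / of_int q) = W_kernel_generated G {pp (q \<^bold>* x \<^bold>- p \<^bold>* \<^bold>1)}"
proof
  let ?y = "q \<^bold>* x \<^bold>- p \<^bold>* \<^bold>1"
  have K: "W_ideal (W_kernel_generated G {pp ?y})" using x by (intro W_ideal_generated) auto
  show "upper_kernel x (of_int p / of_int q) \<subseteq> W_kernel_generated G {pp ?y}"
    unfolding upper_kernel_subset_iff[OF K]
  proof (intro allI impI)
    fix p' q' :: int
    assume q': "0 < q'" and "real_of_int p / of_int q < of_int p' / of_int q'"
    then have "real_of_int (p * q') \<le> of_int (p' * q)" using q by (simp add: field_simps)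
    then have "p * q' \<le> p' * q" by (simp only: of_int_le_iff)
    then show "pp (q' \<^bold>* x \<^bold>- p' \<^bold>* \<^bold>1) \<in> W_kernel_generated G {pp ?y}"
      using affine_compare[OF K x q q'] generated_inc[of "pp ?y"] by simp
  qed
  let ?J = "upper_kernel x (of_int p / of_int q)"
  have J: "W_ideal ?J" using x by simp
  \<comment> \<open>For \<open>n > 0\<close> this is the generator at
    \<open>(n p + 1)/(n q)\<close>, which exceeds \<open>p/q\<close> by
    \<open>1/(n q)\<close>.\<close>
  have step: "pp (int n \<^bold>* ?y \<^bold>- \<^bold>1) \<in> ?J" for n
  proof (cases "n = 0")
    case True
    have "pp (\<^bold>0 \<^bold>- \<^bold>1) = \<^bold>0" by (simp add: pos_part_eq_zero_iff vminus_le_iff)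
    then show ?thesis using True W_ideal_zero[OF J] by simp
  next
    case False
    have "pp ((int n * q) \<^bold>* x \<^bold>- (int n * p + 1) \<^bold>* \<^bold>1) \<in> ?J"
      using False q by (intro upper_kernel_mem) (simp_all add: field_simps)
    moreover have "(int n * q) \<^bold>* x \<^bold>- (int n * p + 1) \<^bold>* \<^bold>1 = int n \<^bold>* ?y \<^bold>- \<^bold>1"
    proof -
      have "(int n * q) \<^bold>* x \<^bold>- ((int n * p) \<^bold>* \<^bold>1 \<^bold>+ \<^bold>1) = ((int n * q) \<^bold>* x \<^bold>- (int n * p) \<^bold>* \<^bold>1) \<^bold>- \<^bold>1"
        using x by algebra
      then show ?thesis using x by (simp add: vscale_affine vscale_add_left)
    qed
    ultimately show ?thesis by simp
  qed
  \<comment> \<open>\<open>W_ideal_arch\<close> needs multiples of the nonnegative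
    \<open>pp ?y\<close>. As the unit is nonnegative, \<open>pp ?z\<close> minus the unit is still
    at most \<open>pp\<close> of \<open>?z\<close> minus the unit.\<close>
  have "pp (int n \<^bold>* pp ?y \<^bold>- \<^bold>1) \<in> ?J" for n
  proof -
    let ?z = "int n \<^bold>* ?y"
    have "?z = \<^bold>1 \<^bold>+ (?z \<^bold>- \<^bold>1)" using x by algebra
    then have "?z \<sqsubseteq> \<^bold>1 \<^bold>+ pp (?z \<^bold>- \<^bold>1)"
      using x vplus_le_cancel_left[of "?z \<^bold>- \<^bold>1" "pp (?z \<^bold>- \<^bold>1)" "\<^bold>1"] by (simp add: le_pos_part)
    moreover have "\<^bold>0 \<sqsubseteq> \<^bold>1 \<^bold>+ pp (?z \<^bold>- \<^bold>1)"
      using x vplus_mono[of "\<^bold>0" "\<^bold>1" "\<^bold>0" "pp (?z \<^bold>- \<^bold>1)"] by simp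
    ultimately have "pp ?z \<^bold>- \<^bold>1 \<sqsubseteq> pp (?z \<^bold>- \<^bold>1)"
      using x by (simp add: vminus_le_iff pos_part_le)
    then have "pp (pp ?z \<^bold>- \<^bold>1) \<in> ?J"
      using W_ideal_pos_part_le[OF J, of "pp (?z \<^bold>- \<^bold>1)" "pp ?z \<^bold>- \<^bold>1"] x step[of n] by simp
    then show ?thesis using x by (simp add: vscale_pos_part)
  qed
  then have "pp ?y \<in> ?J" using W_ideal_arch[OF J, of "pp ?y" "\<^bold>1"] x by simp
  then show "W_kernel_generated G {pp ?y} \<subseteq> ?J" by (simp add: generated_subset_iff[OF J])
qed

lemma upper_kernel_antimono:
  assumes "x \<in> carrier G" "r \<le> s"
  shows "upper_kernel x s \<subseteq> upper_kernel x r"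
  using assms upper_kernel_mem by (auto simp: upper_kernel_subset_iff)

lemma upper_kernel_approx:
  assumes "\<And>s. r < s \<Longrightarrow> upper_kernel x s \<subseteq> K" "W_ideal K"
  shows "upper_kernel x r \<subseteq> K"
  unfolding upper_kernel_subset_iff[OF assms(2)]
proof (intro allI impI)
  fix p q :: int assume "0 < q" "r < of_int p / of_int q"
  moreover from this obtain s where "r < s" "s < of_int p / of_int q" using dense by blast
  ultimately show "pp (q \<^bold>* x \<^bold>- p \<^bold>* \<^bold>1) \<in> K" using assms(1)[of s] upper_kernel_mem[of q s p x] by auto
qed

text \<open>The positive part of \<open>x + n\<close> is in \<open>K\<close> for every
  \<open>n\<close>, so modulo \<open>K\<close> all multiples of the unit lie below
  \<open>neg x\<close>, and the archimedean clause puts the unit in \<open>K\<close>.\<close>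

lemma upper_kernel_eq_carrier:
  assumes "\<And>r. upper_kernel x r \<subseteq> K" "W_ideal K" "x \<in> carrier G"
  shows "K = carrier G"
proof -
  have "pp (int n \<^bold>* \<^bold>1 \<^bold>- neg x) \<in> K" for n
  proof -
    \<comment> \<open>The generators require \<open>r\<close> strictly below \<open>- n\<close>;
      \<open>- n - 1\<close> serves.\<close>
    have "pp (1 \<^bold>* x \<^bold>- (- int n) \<^bold>* \<^bold>1) \<in> upper_kernel x (- real n - 1)"
      by (rule upper_kernel_mem) auto
    moreover have "x \<^bold>- neg (int n \<^bold>* \<^bold>1) = int n \<^bold>* \<^bold>1 \<^bold>- neg x" using assms(3) by algebra
    ultimately show ?thesis using assms by (auto simp: vscale_neg_left)
  qed
  then have "\<^bold>1 \<in> K" using W_ideal_arch[OF assms(2), of "\<^bold>1" "neg x"] assms(3) by simp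
  then show ?thesis by (rule W_ideal_eq_carrier[OF assms(2)])
qed

text \<open>It suffices to treat generators. From \<open>- p'/q' < s \<le> r < p/q\<close>, the
  cleared elements \<open>?x\<close> and \<open>?y\<close> add up to a nonpositive multiple of the
  unit. So \<open>?y \<sqsubseteq> neg ?x\<close>, and the generators lie below the disjoint
  \<open>pp ?x\<close> and \<open>pp (neg ?x)\<close>.\<close>

lemma upper_kernel_disjoint:
  assumes x: "x \<in> carrier G" and "s \<le> r"
  shows "upper_kernel x r \<inter> upper_kernel (neg x) (- s) = {\<^bold>0}"
  unfolding upper_kernel_def
proof (rule generated_disjoint)
  fix a b
  assume "a \<in> {pp (q \<^bold>* x \<^bold>- p \<^bold>* \<^bold>1) | p q. 0 < q \<and> r < of_int p / of_int q}"
    and "b \<in> {pp (q \<^bold>* neg x \<^bold>- p \<^bold>* \<^bold>1) | p q. 0 < q \<and> - s < of_int p / of_int q}"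
  then obtain p q p' q' where a: "a = pp (q \<^bold>* x \<^bold>- p \<^bold>* \<^bold>1)" and q: "0 < q" "r < of_int p / of_int q"
    and b: "b = pp (q' \<^bold>* neg x \<^bold>- p' \<^bold>* \<^bold>1)" and q': "0 < q'" "- s < of_int p' / of_int q'"
    by blast
  have "0 < real_of_int p / of_int q + of_int p' / of_int q'" using q(2) q'(2) assms(2) by linarith
  then have "0 < real_of_int (p * q' + p' * q)" using q(1) q'(1) by (simp add: field_simps)
  then have pos: "0 \<le> p * q' + p' * q" by linarith
  let ?x = "q' \<^bold>* (q \<^bold>* x \<^bold>- p \<^bold>* \<^bold>1)" and ?y = "q \<^bold>* (q' \<^bold>* neg x \<^bold>- p' \<^bold>* \<^bold>1)"
  have "?x \<^bold>+ ?y = neg ((p * q' + p' * q) \<^bold>* \<^bold>1)"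
  proof -
    have "(q' * q) \<^bold>* x \<^bold>- (q' * p) \<^bold>* \<^bold>1 \<^bold>+ (neg ((q' * q) \<^bold>* x) \<^bold>- (q * p') \<^bold>* \<^bold>1) =
        neg ((q' * p) \<^bold>* \<^bold>1 \<^bold>+ (q * p') \<^bold>* \<^bold>1)"
      using x by algebra
    then show ?thesis using x by (simp add: vscale_vminus vscale_vscale vscale_vneg vscale_add_left mult.commute)
  qed
  also have "\<dots> \<sqsubseteq> \<^bold>0" using vneg_le_iff[of _ "\<^bold>0"] vscale_nonneg[OF _ _ pos, of "\<^bold>1"] by simp
  finally have "?y \<sqsubseteq> neg ?x"
    using x le_vminus_iff[of ?y "\<^bold>0" ?x] by (simp add: gminus_def)
  then have "pp ?y \<sqsubseteq> pp (neg ?x)" using x by (intro pos_part_mono) auto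
  moreover have "b \<sqsubseteq> pp ?y" "a \<sqsubseteq> pp ?x"
    using vscale_mono_left[of b 1 q] vscale_mono_left[of a 1 q'] q(1) q'(1) x a b
    by (simp_all flip: vscale_pos_part)
  ultimately have "a \<sqinter> b \<sqsubseteq> pp ?x \<sqinter> pp (neg ?x)"
    using x a b le_trans[of b "pp ?y" "pp (neg ?x)"] by (intro meet_mono) auto
  then have "a \<sqinter> b \<sqsubseteq> \<^bold>0" using x by (simp add: pos_part_disjoint)
  then show "a \<sqinter> b = \<^bold>0" using x a b by (intro le_antisym) (auto simp: meet_nonneg)
qed (use x in auto)

text \<open>Two rationals \<open>p/q < p'/q'\<close> strictly between \<open>r\<close> and
  \<open>s\<close> are chosen so that, in the sum of the cleared elements, \<open>x\<close> cancels
  and a strictly positive multiple of the unit remains. The sign in \<open>- p'\<close> reflects the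
  passage to \<open>neg x\<close>.\<close>

lemma upper_kernel_cover:
  assumes x: "x \<in> carrier G" and "r < s" and K: "W_ideal K"
    and sub: "upper_kernel x r \<subseteq> K" "upper_kernel (neg x) (- s) \<subseteq> K"
  shows "K = carrier G"
proof -
  obtain p q :: int where q: "0 < q" "r < of_int p / of_int q" "of_int p / of_int q < s"
    using rational_between[OF assms(2)] .
  obtain p' q' :: int where q': "0 < q'" "of_int p / of_int q < (of_int p' / of_int q' :: real)"
    "of_int p' / of_int q' < s"
    using rational_between[OF q(3)] .
  let ?x = "q' \<^bold>* (q \<^bold>* x \<^bold>- p \<^bold>* \<^bold>1)" and ?y = "q \<^bold>* (q' \<^bold>* neg x \<^bold>- (- p') \<^bold>* \<^bold>1)"
  have "pp (q \<^bold>* x \<^bold>- p \<^bold>* \<^bold>1) \<in> K" "pp (q' \<^bold>* neg x \<^bold>- (- p') \<^bold>* \<^bold>1) \<in> K"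
    using upper_kernel_mem[OF q(1,2), of x] upper_kernel_mem[OF q'(1), of "- s" "- p'" "neg x"] q'(3) sub
    by auto
  then have "pp ?x \<in> K" "pp ?y \<in> K" using q(1) q'(1) x by (simp_all add: W_ideal_pos_part_vscale_iff[OF K])
  then have "pp (?x \<^bold>+ ?y) \<in> K" using W_ideal_pos_part_vplus[OF K] x by simp
  moreover have "?x \<^bold>+ ?y = (q * p' - q' * p) \<^bold>* \<^bold>1"
  proof -
    have "(q' * q) \<^bold>* x \<^bold>- (q' * p) \<^bold>* \<^bold>1 \<^bold>+ (neg ((q' * q) \<^bold>* x) \<^bold>- neg ((q * p') \<^bold>* \<^bold>1)) =
        (q * p') \<^bold>* \<^bold>1 \<^bold>- (q' * p) \<^bold>* \<^bold>1"
      using x by algebra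
    then show ?thesis
      using x by (simp add: vscale_vminus vscale_vscale vscale_vneg vscale_neg_left vscale_diff_left mult.commute)
  qed
  moreover have "0 < q * p' - q' * p"
  proof -
    have "real_of_int (q' * p) < of_int (q * p')" using q(1) q'(1,2) by (simp add: field_simps)
    then show ?thesis by linarith
  qed
  ultimately have "pp \<^bold>1 \<in> K" using W_ideal_pos_part_vscale_iff[OF K, of "\<^bold>1"] by simp
  then have "\<^bold>1 \<in> K" by (simp add: pos_part_of_nonneg)
  then show ?thesis by (rule W_ideal_eq_carrier[OF K])
qed

text \<open>\<open>x < s\<close> means \<open>neg x > - s\<close>, so the lower value of
  \<open>x\<close> is an upper value of \<open>neg x\<close>. Every axiom on \<open>d\<close> is
  then an instance of the corresponding fact on upper kernels.\<close>

lemma madden_real_cut: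
  assumes x: "x \<in> carrier G"
  shows "real_cut (madden_frame G) (upper_kernel x) (\<lambda>s. upper_kernel (neg x) (- s))"
proof -
  interpret M: frame "madden_frame G" by (rule madden_frame_frame)
  have nx: "neg x \<in> carrier G" using x by simp
  show ?thesis
  proof (unfold_locales, goal_cases)
    case (3 s r) then show ?case
      using x nx by (simp add: madden_meet madden_bottom upper_kernel_disjoint)
  next
    case (4 r s y) then show ?case using upper_kernel_cover[OF x] by (simp add: madden_top)
  next
    case (5 r s) then show ?case using upper_kernel_antimono[OF x] by simp
  next
    case (6 r s) then show ?case using upper_kernel_antimono[OF nx] by simp
  next
    case (7 r y) then show ?case using upper_kernel_approx[of r x y] by simp
  next
    case (8 s y)
    have "upper_kernel (neg x) t \<subseteq> y" if "- s < t" for t using 8(1)[of "- t"] that by simp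
    then show ?case using 8(2) upper_kernel_approx[of "- s" "neg x" y] by simp
  next
    case (9 y) then show ?case using upper_kernel_eq_carrier[of x y] x by (simp add: madden_top)
  next
    case (10 y)
    have "upper_kernel (neg x) t \<subseteq> y" for t using 10(1)[of "- t"] by simp
    then show ?case using 10(2) upper_kernel_eq_carrier[of "neg x" y] nx by (simp add: madden_top)
  qed (use x nx in simp_all)
qed

text \<open>Resolves the definite description: the cut supplies a frame map with the prescribed
  values, and the join clause extends agreement from rational to real rays, where
  \<open>frame_reals_eq_cut_map\<close> gives uniqueness.\<close>

lemma madden_rep_eq_cut_map:
  assumes x: "x \<in> carrier G"
  shows "madden_rep G x =
    real_cut.cut_map (madden_frame G) (upper_kernel x) (\<lambda>s. upper_kernel (neg x) (- s))"
    (is "_ = ?f")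
proof -
  interpret C: real_cut "madden_frame G" "upper_kernel x" "\<lambda>s. upper_kernel (neg x) (- s)"
    by (rule madden_real_cut[OF x])
  have sup: "upper_kernel x r = \<Squnion>\<^bsub>madden_frame G\<^esub> {upper_kernel x s | s. s \<in> \<rat> \<and> r < s}" for r
  proof (rule M.le_antisym)
    let ?A = "{upper_kernel x s | s. s \<in> \<rat> \<and> r < s}"
    have A: "?A \<subseteq> carrier (madden_frame G)" using x by auto
    then show "\<Squnion>\<^bsub>madden_frame G\<^esub> ?A \<in> carrier (madden_frame G)" by (rule M.sup_closed)
    show "\<Squnion>\<^bsub>madden_frame G\<^esub> ?A \<sqsubseteq>\<^bsub>madden_frame G\<^esub> upper_kernel x r"
    proof (rule M.sup_least[OF A])
      fix K assume "K \<in> ?A"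
      then show "K \<sqsubseteq>\<^bsub>madden_frame G\<^esub> upper_kernel x r" using upper_kernel_antimono[OF x, of r] by force
    qed (use x in simp)
    \<comment> \<open>A rational between \<open>r\<close> and \<open>t\<close> places this value
      below a member of the join; \<open>upper_kernel_approx\<close> then lets \<open>t\<close> tend
      to \<open>r\<close>.\<close>
    have "upper_kernel x t \<subseteq> \<Squnion>\<^bsub>madden_frame G\<^esub> ?A" if t: "r < t" for t
    proof -
      obtain s where s: "s \<in> \<rat>" "r < s" "s < t" using Rats_dense_in_real[OF t] by blast
      then have "upper_kernel x s \<sqsubseteq>\<^bsub>madden_frame G\<^esub> \<Squnion>\<^bsub>madden_frame G\<^esub> ?A"
        by (intro M.sup_upper[OF A]) auto
      then show ?thesis using upper_kernel_antimono[OF x, of s t] s by auto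
    qed
    then show "upper_kernel x r \<sqsubseteq>\<^bsub>madden_frame G\<^esub> \<Squnion>\<^bsub>madden_frame G\<^esub> ?A"
      using upper_kernel_approx[of r x "\<Squnion>\<^bsub>madden_frame G\<^esub> ?A"] M.sup_closed[OF A] by simp
  qed (use x in simp)
  show ?thesis
    unfolding madden_rep_def
  proof (rule the_equality, intro conjI allI impI)
    show "?f \<in> frame_reals (madden_frame G)" by (rule C.cut_map_frame_reals)
    fix p q :: int assume "0 < q"
    then show "?f {of_int p / of_int q<..} =
        W_kernel_generated G {pp (q \<^bold>* x \<^bold>- p \<^bold>* \<^bold>1)}"
      by (simp add: C.cut_map_greaterThan upper_kernel_rational[OF x])
  next
    fix r show "?f {r<..} = \<Squnion>\<^bsub>madden_frame G\<^esub> {?f {s<..} | s. s \<in> \<rat> \<and> r < s}"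
      using sup[of r] by (simp add: C.cut_map_greaterThan)
  next
    fix f assume "f \<in> frame_reals (madden_frame G) \<and>
        (\<forall>p q :: int. 0 < q \<longrightarrow> f {of_int p / of_int q<..} =
             W_kernel_generated G {pp (q \<^bold>* x \<^bold>- p \<^bold>* \<^bold>1)}) \<and>
        (\<forall>r. f {r<..} = \<Squnion>\<^bsub>madden_frame G\<^esub> {f {s<..} | s. s \<in> \<rat> \<and> r < s})"
    then have f: "f \<in> frame_reals (madden_frame G)"
      and f_rat: "\<And>p q :: int. 0 < q \<Longrightarrow> f {of_int p / of_int q<..} =
             W_kernel_generated G {pp (q \<^bold>* x \<^bold>- p \<^bold>* \<^bold>1)}"
      and f_sup: "\<And>r. f {r<..} = \<Squnion>\<^bsub>madden_frame G\<^esub> {f {s<..} | s. s \<in> \<rat> \<and> r < s}"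
      by metis+
    have rat: "f {s<..} = upper_kernel x s" if sQ: "s \<in> \<rat>" for s
    proof -
      obtain p q :: int where q: "0 < q" and s: "s = of_int p / of_int q"
        using sQ by (metis Rats_cases')
      show ?thesis unfolding s upper_kernel_rational[OF x q] by (rule f_rat[OF q])
    qed
    have "f {r<..} = upper_kernel x r" for r
    proof -
      have "{f {s<..} | s. s \<in> \<rat> \<and> r < s} = {upper_kernel x s | s. s \<in> \<rat> \<and> r < s}"
        using rat by metis
      then show ?thesis unfolding f_sup[of r] sup[of r] by simp
    qed
    then show "f = ?f" by (rule C.frame_reals_eq_cut_map[OF f])
  qed
qed

section \<open>Ray values of the representation under order and truncation\<close>

lemma madden_rep_frame_reals:
  "x \<in> carrier G \<Longrightarrow> madden_rep G x \<in> frame_reals (madden_frame G)"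
  by (simp add: madden_rep_eq_cut_map real_cut.cut_map_frame_reals madden_real_cut)

lemma madden_rep_greaterThan:
  "x \<in> carrier G \<Longrightarrow> madden_rep G x {r<..} = upper_kernel x r"
  by (simp add: madden_rep_eq_cut_map real_cut.cut_map_greaterThan[OF madden_real_cut])

lemma madden_rep_lessThan:
  "x \<in> carrier G \<Longrightarrow> madden_rep G x {..<s} = upper_kernel (neg x) (- s)"
  by (simp add: madden_rep_eq_cut_map real_cut.cut_map_lessThan[OF madden_real_cut])

lemma upper_kernel_mono:
  assumes "x \<sqsubseteq> y" "x \<in> carrier G" "y \<in> carrier G"
  shows "upper_kernel x r \<subseteq> upper_kernel y r"
proof -
  have "pp (q \<^bold>* x \<^bold>- p \<^bold>* \<^bold>1) \<in> upper_kernel y r" if q: "0 < q" "r < of_int p / of_int q" for p q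
  proof (rule W_ideal_pos_part_le[OF _ upper_kernel_mem[OF q]])
    show "q \<^bold>* x \<^bold>- p \<^bold>* \<^bold>1 \<sqsubseteq> q \<^bold>* y \<^bold>- p \<^bold>* \<^bold>1"
      using assms q by (simp add: vminus_mono vscale_mono)
  qed (use assms in auto)
  then show ?thesis using assms by (simp add: upper_kernel_subset_iff)
qed

text \<open>Negation turns the truncation into a join of \<open>neg y\<close> with
  \<open>- k\<close> times the unit. For \<open>p/q > - s \<ge> - k\<close> the second member
  contributes a nonpositive element, whose positive part vanishes: cutting at \<open>k\<close> is
  invisible below \<open>s \<le> k\<close>.\<close>

lemma upper_kernel_truncate:
  assumes y: "y \<in> carrier G" and k: "s \<le> of_int k"
  shows "upper_kernel (neg (y \<sqinter> k \<^bold>* \<^bold>1)) (- s) = upper_kernel (neg y) (- s)"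
proof
  let ?x = "y \<sqinter> k \<^bold>* \<^bold>1"
  show "upper_kernel (neg y) (- s) \<subseteq> upper_kernel (neg ?x) (- s)"
    using y by (intro upper_kernel_mono) (auto simp: vneg_le_iff meet_left)
  let ?K = "upper_kernel (neg y) (- s)"
  have K: "W_ideal ?K" using y by simp
  have "pp (q \<^bold>* neg ?x \<^bold>- p \<^bold>* \<^bold>1) \<in> ?K" if q: "0 < q" "- s < of_int p / of_int q" for p q
  proof -
    have "- real_of_int k < of_int p / of_int q" using q(2) k by linarith
    then have "real_of_int (- p) < of_int (q * k)" using q(1) by (simp add: field_simps)
    then have "0 \<le> q * k + p" by linarith
    then have "\<^bold>0 \<sqsubseteq> (q * k) \<^bold>* \<^bold>1 \<^bold>+ p \<^bold>* \<^bold>1"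
      using vscale_nonneg[of "\<^bold>1" "q * k + p"] by (simp add: vscale_add_left)
    moreover have "neg ((q * k) \<^bold>* \<^bold>1) \<^bold>- p \<^bold>* \<^bold>1 = neg ((q * k) \<^bold>* \<^bold>1 \<^bold>+ p \<^bold>* \<^bold>1)"
      by (simp add: gminus_def vneg_vplus)
    ultimately have "neg ((q * k) \<^bold>* \<^bold>1) \<^bold>- p \<^bold>* \<^bold>1 \<sqsubseteq> \<^bold>0"
      using vneg_le_iff[of "(q * k) \<^bold>* \<^bold>1 \<^bold>+ p \<^bold>* \<^bold>1" "\<^bold>0"] by simp
    then have "pp (neg ((q * k) \<^bold>* \<^bold>1) \<^bold>- p \<^bold>* \<^bold>1) \<in> ?K"
      using W_ideal_zero[OF K] by (simp add: pos_part_eq_zero_iff[THEN iffD2])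
    moreover have "pp (neg (q \<^bold>* y) \<^bold>- p \<^bold>* \<^bold>1) \<in> ?K"
      using upper_kernel_mem[OF q, of "neg y"] y by (simp add: vscale_vneg)
    moreover have "q \<^bold>* neg ?x \<^bold>- p \<^bold>* \<^bold>1 =
        (neg (q \<^bold>* y) \<^bold>- p \<^bold>* \<^bold>1) \<squnion> (neg ((q * k) \<^bold>* \<^bold>1) \<^bold>- p \<^bold>* \<^bold>1)"
    proof -
      have "q \<^bold>* neg ?x = neg (q \<^bold>* y \<sqinter> (q * k) \<^bold>* \<^bold>1)"
        using y q(1) by (simp add: vscale_vneg vscale_meet vscale_vscale)
      then show ?thesis using y by (simp add: vneg_meet vminus_join)
    qed
    ultimately show ?thesis using W_ideal_pos_part_join[OF K] y by simp
  qed
  then show "upper_kernel (neg ?x) (- s) \<subseteq> ?K" by (simp add: upper_kernel_subset_iff[OF K])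
qed

end

theorem corollary5p2p4:
  fixes G :: "'a wgroup" and g :: "nat \<Rightarrow> 'a"
  assumes "W_object G"
    and "truncate_sequence G g"
  shows "\<exists>h. is_pointwise_join (madden_frame G) {madden_rep G (g n) | n. n \<ge> 1} h"
proof -
  interpret W_object G by fact
  have g: "g n \<in> carrier G" "g (Suc n) \<sqinter>\<^bsub>G\<^esub> zmult G (int n) (gunit G) = g n" if "n \<ge> 1" for n
    using assms(2) that by (auto simp: truncate_sequence_def)
  define U where "U n = upper_kernel (g n)" for n
  define D where "D n s = upper_kernel (inv\<^bsub>add_group G\<^esub> (g n)) (- s)" for n s
  have top: "\<Squnion>\<^bsub>madden_frame G\<^esub> {D n (real n) | n. 1 \<le> n} = \<top>\<^bsub>madden_frame G\<^esub>"
  proof -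
    have "{D n (real n) | n. 1 \<le> n} = {madden_rep G (g n) {..<real n} | n. n \<ge> 1}"
      using g(1) by (force simp: D_def madden_rep_lessThan)
    then show ?thesis using assms(2) by (simp add: truncate_sequence_def)
  qed
  interpret h: real_cut "madden_frame G" "\<lambda>r. \<Squnion>\<^bsub>madden_frame G\<^esub> {U n r | n. 1 \<le> n}"
    "\<lambda>s. D (Suc (nat \<lceil>s\<rceil>)) s"
  \<comment> \<open>The truncation equation is used twice: as
    \<open>g n \<sqsubseteq> g (Suc n)\<close> for the growth of the upper values, and through
    \<open>upper_kernel_truncate\<close> with \<open>k = n\<close> for the stability of the lower
    ones.\<close>
  proof (rule real_cut_of_truncates)
    fix n :: nat assume n: "1 \<le> n"
    show "real_cut (madden_frame G) (U n) (D n)"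
      unfolding U_def D_def using madden_real_cut[OF g(1)[OF n]] .
    fix r
    show "U n r \<sqsubseteq>\<^bsub>madden_frame G\<^esub> U (Suc n) r"
      using upper_kernel_mono[of "g n" "g (Suc n)" r] g[OF n] g(1)[of "Suc n"]
        meet_left[of "g (Suc n)" "zmult G (int n) (gunit G)"] by (simp add: U_def)
  next
    fix n :: nat and s assume n: "1 \<le> n" "s \<le> real n"
    then show "D (Suc n) s = D n s"
      using upper_kernel_truncate[of "g (Suc n)" s "int n"] g[OF n(1)] g(1)[of "Suc n"] by (simp add: D_def)
  qed (rule top)
  have "is_pointwise_join (madden_frame G) {madden_rep G (g n) | n. n \<ge> 1} h.cut_map"
    unfolding is_pointwise_join_def
  proof (intro conjI allI)
    show "h.cut_map \<in> frame_reals (madden_frame G)" by (rule h.cut_map_frame_reals)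
    show "{madden_rep G (g n) | n. n \<ge> 1} \<subseteq> frame_reals (madden_frame G)"
      using g(1) madden_rep_frame_reals by auto
    fix r
    have "(\<lambda>k. k {r<..}) ` {madden_rep G (g n) | n. n \<ge> 1} = {madden_rep G (g n) {r<..} | n. n \<ge> 1}"
      by blast
    also have "\<dots> = {U n r | n. 1 \<le> n}"
      using g(1) by (force simp: U_def madden_rep_greaterThan)
    finally show "h.cut_map {r<..} =
        \<Squnion>\<^bsub>madden_frame G\<^esub> ((\<lambda>k. k {r<..}) ` {madden_rep G (g n) | n. n \<ge> 1})"
      by (simp only: h.cut_map_greaterThan)
  qed
  then show ?thesis by blast
qed

end
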